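(* Let $q\ge 0$ and $s\ge 3$ be integers, and let $G=K_1\vee (C_s\cup qK_2)$. If $G$ has at least $16$ vertices (i.e. $s+2q+1\ge 16$), then $G$ is determined by its signless Laplacian spectrum: every simple graph whose signless Laplacian spectrum equals that of $G$ is isomorphic to $G$.
   Context: All graphs are finite, simple and undirected unless stated otherwise. $K_n$, $C_n$ denote the complete graph and the cycle on $n$ vertices; $G\cup H$ is the disjoint union; $qG$ is the disjoint union of $q$ copies of $G$ ($0K_2$ is the empty graph); $G\vee H$ is the join, obtained from $G\cup H$ by adding all edges between $V(G)$ and $V(H)$. The signless Laplacian of $G$ is $Q(G)=A(G)+D(G)$, where $A(G)$ is the adjacency matrix and $D(G)$ the diagonal matrix of vertex degrees; its eigenvalues (with multiplicities) form the signless Laplacian spectrum ($Q$-spectrum). A graph is DQS (determined by its signless Laplacian spectrum) if no non-isomorphic graph has the same $Q$-spectrum. *)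

theory Defs
  imports "Jordan_Normal_Form.Char_Poly"
begin

text \<open>A finite simple graph is represented by a pair (n, E): its vertex set is {0..<n}
  and E is its adjacency relation (symmetric, irreflexive, and only relating vertices < n).\<close>

type_synonym graph = "nat \<times> (nat \<Rightarrow> nat \<Rightarrow> bool)"

definition simple_graph :: "graph \<Rightarrow> bool" where
  "simple_graph G \<longleftrightarrow> (case G of (n, E) \<Rightarrow>
      (\<forall>i j. E i j \<longrightarrow> i < n \<and> j < n) \<and> (\<forall>i j. E i j \<longrightarrow> E j i) \<and> (\<forall>i. \<not> E i i))"

definition complete_graph :: "nat \<Rightarrow> graph" ("K") where
  "K n = (n, \<lambda>i j. i < n \<and> j < n \<and> i \<noteq> j)"

definition cycle_graph :: "nat \<Rightarrow> graph" ("C") where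
  "C s = (s, \<lambda>i j. i < s \<and> j < s \<and> i \<noteq> j \<and> (j = (i + 1) mod s \<or> i = (j + 1) mod s))"

definition disj_union :: "graph \<Rightarrow> graph \<Rightarrow> graph" where
  "disj_union G H = (case G of (n1, E1) \<Rightarrow> case H of (n2, E2) \<Rightarrow>
     (n1 + n2, \<lambda>i j. (i < n1 \<and> j < n1 \<and> E1 i j) \<or>
                    (n1 \<le> i \<and> n1 \<le> j \<and> E2 (i - n1) (j - n1))))"

definition join :: "graph \<Rightarrow> graph \<Rightarrow> graph" where
  "join G H = (case G of (n1, E1) \<Rightarrow> case H of (n2, E2) \<Rightarrow>
     (n1 + n2, \<lambda>i j. (i < n1 \<and> j < n1 \<and> E1 i j) \<or>
                    (n1 \<le> i \<and> n1 \<le> j \<and> E2 (i - n1) (j - n1)) \<or>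
                    (i < n1 \<and> n1 \<le> j \<and> j < n1 + n2) \<or>
                    (j < n1 \<and> n1 \<le> i \<and> i < n1 + n2)))"

fun copies :: "nat \<Rightarrow> graph \<Rightarrow> graph" where
  "copies 0 G = (0, \<lambda>i j. False)"
| "copies (Suc q) G = disj_union G (copies q G)"

definition degree :: "graph \<Rightarrow> nat \<Rightarrow> nat" where
  "degree G i = card {j. j < fst G \<and> snd G i j}"

definition signless_laplacian :: "graph \<Rightarrow> real mat" where
  "signless_laplacian G = mat (fst G) (fst G)
     (\<lambda>(i, j). (if snd G i j then 1 else 0) + (if i = j then real (degree G i) else 0))"

text \<open>Q-spectrum: each real number is mapped to its multiplicity as an eigenvalue of Q(G)
  (algebraic multiplicity = multiplicity as root of the characteristic polynomial).
  Since Q(G) is real symmetric, all eigenvalues are real, so this is the full spectrum.\<close>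
definition Q_spectrum :: "graph \<Rightarrow> real \<Rightarrow> nat" where
  "Q_spectrum G = (\<lambda>x. order x (char_poly (signless_laplacian G)))"

definition graph_iso :: "graph \<Rightarrow> graph \<Rightarrow> bool" where
  "graph_iso G H \<longleftrightarrow> (\<exists>f. bij_betw f {0..<fst G} {0..<fst H} \<and>
      (\<forall>i<fst G. \<forall>j<fst G. snd G i j \<longleftrightarrow> snd H (f i) (f j)))"

end

theory Submission
  imports Defs "Jordan_Normal_Form.Spectral_Radius"
begin

text \<open>
  Write \<open>T\<close> for the join and \<open>n\<close> for its order. The spectrum of \<open>T\<close> has exactly one eigenvalue
  that is at least \<open>5\<close>, and this eigenvalue \<open>lam\<close> exceeds \<open>n\<close>. Let \<open>H\<close> have the same spectrum.

  Two vertices of degree at least \<open>6\<close> in \<open>H\<close> would span a plane on which the quadratic form of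
  \<open>Q\<close> is at least \<open>5\<close> times the norm, so all vertices but one vertex \<open>v\<close> have degree at most \<open>5\<close>.
  An eigenvector \<open>x\<close> for \<open>lam\<close> with \<open>x v = 1\<close> is then at most \<open>1 / (lam - 9)\<close> elsewhere, and the
  eigenvalue equation at \<open>v\<close> forces \<open>v\<close> to be adjacent to all other vertices once \<open>n \<ge> 16\<close>.
  The traces of \<open>Q\<close> and \<open>Q\<^sup>2\<close> determine the sum of \<open>(d - 2) * (d - 3)\<close> over all degrees \<open>d\<close>; it
  vanishes off the apex in \<open>T\<close>, so also in \<open>H\<close>, and \<open>H\<close> has the degrees of \<open>T\<close>.

  Now pair \<open>x\<close> with the vector that has the entries of the eigenvector of \<open>T\<close> for \<open>lam\<close>,
  distributed according to degree. What remains is a sum of \<open>x e - x f\<close> over the edges from a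
  vertex \<open>e\<close> of degree \<open>2\<close> to a vertex \<open>f\<close> of degree \<open>3\<close>; positivity of \<open>x\<close> makes every term
  negative, so there are no such edges. Hence the vertices of degree \<open>2\<close> are matched among
  themselves and those of degree \<open>3\<close> form cycles, and two cycles would again give a plane on which
  the form is \<open>5\<close> times the norm.
\<close>

section \<open>Orthogonal diagonalization of real symmetric matrices\<close>

text \<open>The Hermitian form of \<open>A\<close> at \<open>v\<close> is its own conjugate and
  equals \<open>k\<close> times the positive squared norm of \<open>v\<close>.\<close>

lemma symmetric_complex_eigenvalue_real:
  fixes A :: "real mat"
  assumes A: "A \<in> carrier_mat n n" and sym: "transpose_mat A = A"
    and ev: "eigenvector (map_mat complex_of_real A) v k"
  shows "k \<in> \<real>"
proof -
  have v: "v \<in> carrier_vec n" "v \<noteq> 0\<^sub>v n"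
    and Av: "map_mat complex_of_real A *\<^sub>v v = k \<cdot>\<^sub>v v"
    using ev A unfolding eigenvector_def by auto
  have symA: "A $$ (i,j) = A $$ (j,i)" if "i < n" "j < n" for i j
    using that A sym by (metis carrier_matD(1) carrier_matD(2) index_transpose_mat(1))
  have row: "(\<Sum>j<n. complex_of_real (A $$ (i,j)) * v $ j) = k * v $ i" if i: "i < n" for i
  proof -
    have "(map_mat complex_of_real A *\<^sub>v v) $ i = k * v $ i"
      unfolding Av using v i by simp
    thus ?thesis using A v i by (simp add: scalar_prod_def lessThan_atLeast0)
  qed
  define S where "S = (\<Sum>i<n. \<Sum>j<n. cnj (v $ i) * (complex_of_real (A $$ (i,j)) * v $ j))"
  define N where "N = (\<Sum>i<n. (cmod (v $ i))\<^sup>2)"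
  have "S = (\<Sum>i<n. cnj (v $ i) * (k * v $ i))"
    unfolding S_def by (rule sum.cong) (simp_all add: row flip: sum_distrib_left)
  also have "\<dots> = k * of_real N"
    unfolding N_def of_real_sum sum_distrib_left
    by (rule sum.cong) (simp_all only: complex_norm_square, simp_all add: mult_ac)
  finally have S: "S = k * of_real N" .
  have "cnj S = (\<Sum>i<n. \<Sum>j<n. cnj (v $ j) * (complex_of_real (A $$ (i,j)) * v $ i))"
    unfolding S_def by (simp add: mult_ac)
  also have "\<dots> = (\<Sum>j<n. \<Sum>i<n. cnj (v $ j) * (complex_of_real (A $$ (i,j)) * v $ i))"
    by (rule sum.swap)
  also have "\<dots> = S"
    unfolding S_def by (intro sum.cong refl) (simp add: symA)
  finally have "cnj S = S" .
  moreover have "N \<noteq> 0"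
  proof -
    obtain i where "i < n" "v $ i \<noteq> 0" using v by force
    hence "N > 0" unfolding N_def by (intro sum_pos2[of _ i]) auto
    thus ?thesis by simp
  qed
  ultimately have "cnj k = k" using S by simp
  thus ?thesis by (simp add: Reals_cnj_iff)
qed

text \<open>A complex eigenvalue exists and is real, hence a root of the real characteristic
  polynomial, which provides a real eigenvector.\<close>

lemma symmetric_real_eigenvector:
  fixes A :: "real mat"
  assumes A: "A \<in> carrier_mat n n" and sym: "transpose_mat A = A" and n: "n > 0"
  shows "\<exists>v k. eigenvector A v k"
proof -
  let ?B = "map_mat complex_of_real A"
  have B: "?B \<in> carrier_mat n n" using A by simp
  obtain k where k: "eigenvalue ?B k"
    using spectrum_non_empty[OF B n] unfolding spectrum_def by auto
  then obtain r where r: "k = complex_of_real r"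
    using symmetric_complex_eigenvalue_real[OF A sym] unfolding eigenvalue_def
    by (meson Reals_cases)
  have "poly (char_poly ?B) (complex_of_real r) = 0"
    using k eigenvalue_root_char_poly[OF B] r by simp
  hence "poly (char_poly A) r = 0"
    unfolding of_real_hom.char_poly_hom[OF A] by simp
  thus ?thesis using eigenvalue_root_char_poly[OF A] unfolding eigenvalue_def by blast
qed

text \<open>The Householder reflection that exchanges a unit vector and the first basis vector. If the
  two coincide then the coefficient is \<open>2 / 0 = 0\<close> and the reflection is the identity.\<close>

lemma orthogonal_symmetric_mat_first_col:
  fixes u :: "nat \<Rightarrow> real"
  assumes unit: "(\<Sum>i<n. (u i)\<^sup>2) = 1" and n: "n > 0"
  shows "\<exists>P. P \<in> carrier_mat n n \<and> transpose_mat P = P \<and> P * P = 1\<^sub>m n \<and> (\<forall>i<n. P $$ (i,0) = u i)"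
proof -
  define w where "w i = u i - (if i = 0 then 1 else 0)" for i :: nat
  define N where "N = (\<Sum>i<n. (w i)\<^sup>2)"
  define c where "c = 2 / N"
  define P where "P = mat n n (\<lambda>(i,j). (if i = j then 1 else 0) - c * w i * w j)"
  have P: "P \<in> carrier_mat n n" unfolding P_def by simp
  have "N = (\<Sum>i<n. (u i)\<^sup>2 + (if i = 0 then 1 - 2 * u 0 else 0))"
    unfolding N_def w_def by (intro sum.cong) (auto simp: power2_eq_square algebra_simps)
  also have "\<dots> = 2 - 2 * u 0" using n by (simp add: sum.distrib unit)
  finally have N: "N = - 2 * w 0" by (simp add: w_def)
  have w0: "w i = 0" if "N = 0" "i < n" for i
    using that unfolding N_def by (simp add: sum_nonneg_eq_0_iff)
  \<comment> \<open>Also true for \<open>N = 0\<close>, since \<open>c = 0\<close> then; this makes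
    \<open>P * P\<close> the identity.\<close>
  have cN: "c * c * N = 2 * c" unfolding c_def by simp
  have PP: "P * P = 1\<^sub>m n"
  proof (rule eq_matI)
    fix i j assume ij: "i < dim_row (1\<^sub>m n :: real mat)" "j < dim_col (1\<^sub>m n :: real mat)"
    hence i: "i < n" and j: "j < n" by auto
    have "(P * P) $$ (i,j) = (\<Sum>k<n. ((if i = k then 1 else 0) - c * w i * w k) *
        ((if k = j then 1 else 0) - c * w k * w j))"
      using i j unfolding P_def by (simp add: scalar_prod_def lessThan_atLeast0)
    also have "\<dots> = (\<Sum>k<n. (if k = i then (if i = j then 1 else 0) - c * w i * w j else 0)
        + (if k = j then - c * w i * w j else 0) + c * c * w i * w j * (w k)\<^sup>2)"
      by (intro sum.cong) (auto simp: power2_eq_square algebra_simps)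
    also have "\<dots> = (if i = j then 1 else 0) - c * w i * w j - c * w i * w j + c * c * w i * w j * N"
      using i j by (simp add: sum.distrib N_def flip: sum_distrib_left)
    also have "\<dots> = (if i = j then 1 else 0) + w i * w j * (c * c * N - 2 * c)"
      by (simp add: algebra_simps)
    finally show "(P * P) $$ (i,j) = 1\<^sub>m n $$ (i,j)" using i j cN by simp
  qed (auto simp: P_def)
  have "P $$ (i,0) = u i" if i: "i < n" for i
  proof (cases "N = 0")
    case True
    thus ?thesis using w0[OF True i] i n unfolding P_def by (auto simp: w_def)
  next
    case False
    hence "c * w 0 = -1" using N unfolding c_def by (simp add: field_simps)
    hence "c * w i * w 0 = - w i" by (metis mult.commute mult.left_commute mult_minus1)
    thus ?thesis using i n unfolding P_def by (auto simp: w_def)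
  qed
  moreover have "transpose_mat P = P"
    unfolding P_def by (rule eq_matI) auto
  ultimately show ?thesis using P PP by blast
qed

text \<open>Deflation by induction: conjugating with the reflection whose first column is a unit
  eigenvector splits off a 1 by 1 block and leaves a smaller symmetric matrix.\<close>

lemma symmetric_real_mat_orthogonally_diagonalizable:
  fixes A :: "real mat"
  assumes "A \<in> carrier_mat n n" and "transpose_mat A = A"
  shows "\<exists>U l. U \<in> carrier_mat n n \<and> U * transpose_mat U = 1\<^sub>m n \<and>
    A = U * mat_diag n l * transpose_mat U"
  using assms
proof (induction n arbitrary: A)
  case 0
  show ?case
    by (rule exI[of _ "1\<^sub>m 0"], rule exI[of _ "\<lambda>_. 0"]) (use 0 in \<open>auto intro!: eq_matI\<close>)
next
  case (Suc n)
  note A = Suc.prems(1)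
  obtain v k where ev: "eigenvector A v k"
    using symmetric_real_eigenvector[OF Suc.prems] by auto
  have v: "v \<in> carrier_vec (Suc n)" "v \<noteq> 0\<^sub>v (Suc n)" and Av: "A *\<^sub>v v = k \<cdot>\<^sub>v v"
    using ev A unfolding eigenvector_def by auto
  define r where "r = sqrt (\<Sum>i<Suc n. (v $ i)\<^sup>2)"
  have "(\<Sum>i<Suc n. (v $ i)\<^sup>2) > 0"
  proof -
    obtain i where i: "i < Suc n" "v $ i \<noteq> 0" using v by force
    show ?thesis by (rule sum_pos2[of _ i]) (use i in auto)
  qed
  hence r: "r > 0" "r\<^sup>2 = (\<Sum>i<Suc n. (v $ i)\<^sup>2)"
    unfolding r_def by (auto simp del: sum.lessThan_Suc)
  define u where "u i = v $ i / r" for i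
  have "(\<Sum>i<Suc n. (u i)\<^sup>2) = 1"
    using r(1) unfolding u_def power_divide sum_divide_distrib[symmetric] r(2)[symmetric] by simp
  then obtain P where P: "P \<in> carrier_mat (Suc n) (Suc n)" "transpose_mat P = P"
    "P * P = 1\<^sub>m (Suc n)" and Pu: "\<And>i. i < Suc n \<Longrightarrow> P $$ (i,0) = u i"
    using orthogonal_symmetric_mat_first_col by blast
  have colP: "col P 0 = (1 / r) \<cdot>\<^sub>v v"
    using P Pu v by (intro eq_vecI) (auto simp: u_def)
  define B where "B = P * A * P"
  have B: "B \<in> carrier_mat (Suc n) (Suc n)" using P A unfolding B_def by auto
  have symB: "transpose_mat B = B"
    using P A Suc.prems(2) unfolding B_def
    by (simp add: transpose_mult[of _ "Suc n" "Suc n" _ "Suc n"] assoc_mult_mat[of _ "Suc n" "Suc n" _ "Suc n" _ "Suc n"])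
  have "col B 0 = P * A *\<^sub>v col P 0"
    unfolding B_def by (rule col_mult2[of _ "Suc n" "Suc n" _ "Suc n"]) (use P A in auto)
  also have "\<dots> = P *\<^sub>v (A *\<^sub>v col P 0)"
    using P A v by (intro assoc_mult_mat_vec[of _ "Suc n" "Suc n" _ "Suc n"]) (auto simp: colP)
  also have "A *\<^sub>v col P 0 = k \<cdot>\<^sub>v col P 0"
    unfolding colP using A v Av
    by (simp add: mult_mat_vec[of _ "Suc n" "Suc n"] smult_smult_assoc mult.commute)
  also have "P *\<^sub>v (k \<cdot>\<^sub>v col P 0) = k \<cdot>\<^sub>v (P *\<^sub>v col P 0)"
    using P(1) v by (intro mult_mat_vec[of _ "Suc n" "Suc n"]) (auto simp: colP)
  also have "P *\<^sub>v col P 0 = col (P * P) 0"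
    using P(1) by (intro col_mult2[symmetric, of _ "Suc n" "Suc n" _ "Suc n"]) auto
  finally have colB: "col B 0 = k \<cdot>\<^sub>v unit_vec (Suc n) 0" unfolding P(3) by simp
  have B0: "B $$ (i,0) = (if i = 0 then k else 0)" if "i < Suc n" for i
  proof -
    have "B $$ (i,0) = col B 0 $ i" using B that by simp
    thus ?thesis unfolding colB using that by simp
  qed
  have B0': "B $$ (0,i) = (if i = 0 then k else 0)" if "i < Suc n" for i
    using B0[OF that] symB B that by (metis carrier_matD index_transpose_mat(1) zero_less_Suc)
  define A' where "A' = mat n n (\<lambda>(i,j). B $$ (Suc i, Suc j))"
  have A': "A' \<in> carrier_mat n n" unfolding A'_def by simp
  have "transpose_mat A' = A'"
  proof (rule eq_matI)
    fix i j assume "i < dim_row A'" "j < dim_col A'"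
    hence "i < n" "j < n" unfolding A'_def by auto
    thus "transpose_mat A' $$ (i,j) = A' $$ (i,j)"
      using symB B unfolding A'_def
      by (simp, metis Suc_mono carrier_matD index_transpose_mat(1))
  qed (auto simp: A'_def)
  from Suc.IH[OF A' this] obtain U l where U: "U \<in> carrier_mat n n"
    "U * transpose_mat U = 1\<^sub>m n" and A'U: "A' = U * mat_diag n l * transpose_mat U" by blast
  define D where "D = four_block_mat (mat_diag 1 (\<lambda>_. k)) (0\<^sub>m 1 n) (0\<^sub>m n 1) (mat_diag n l)"
  define W where "W = four_block_mat (1\<^sub>m 1) (0\<^sub>m 1 n) (0\<^sub>m n 1) U"
  have W: "W \<in> carrier_mat (Suc n) (Suc n)" and D: "D \<in> carrier_mat (Suc n) (Suc n)"
    using U unfolding W_def D_def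
    by (auto intro: four_block_carrier_mat[of _ 1 1 _ n n, simplified])
  have tW: "transpose_mat W = four_block_mat (1\<^sub>m 1) (0\<^sub>m 1 n) (0\<^sub>m n 1) (transpose_mat U)"
    unfolding W_def using U by (subst transpose_four_block_mat[of _ 1 1 _ n _ n]) auto
  have WW: "W * transpose_mat W = 1\<^sub>m (Suc n)"
    unfolding tW unfolding W_def using U
    by (subst mult_four_block_mat[of _ 1 1 _ n _ n _ _ 1 _ n]) auto
  have "W * D = four_block_mat (mat_diag 1 (\<lambda>_. k)) (0\<^sub>m 1 n) (0\<^sub>m n 1) (U * mat_diag n l)"
    unfolding W_def D_def using U mat_diag_dim[of 1 "\<lambda>_. k"] mat_diag_dim[of n l]
    by (subst mult_four_block_mat[of _ 1 1 _ n _ n _ _ 1 _ n]) (auto simp del: mat_diag_dim)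
  hence "W * D * transpose_mat W = four_block_mat (mat_diag 1 (\<lambda>_. k)) (0\<^sub>m 1 n) (0\<^sub>m n 1) A'"
    unfolding tW A'U using U mat_diag_dim[of 1 "\<lambda>_. k"] mat_diag_dim[of n l]
    by (simp, subst mult_four_block_mat[of _ 1 1 _ n _ n _ _ 1 _ n]) (auto simp del: mat_diag_dim)
  also have "\<dots> = B"
  proof (rule eq_matI)
    fix i j assume "i < dim_row B" "j < dim_col B"
    hence ij: "i < Suc n" "j < Suc n" using B by auto
    show "four_block_mat (mat_diag 1 (\<lambda>_. k)) (0\<^sub>m 1 n) (0\<^sub>m n 1) A' $$ (i,j) = B $$ (i,j)"
      using ij A' B0[of i] B0'[of j] by (auto simp: mat_diag_def A'_def)
  qed (use A' B in \<open>auto simp: mat_diag_def\<close>)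
  finally have BW: "B = W * D * transpose_mat W" by simp
  have D': "D = mat_diag (Suc n) (case_nat k l)"
    unfolding D_def mat_diag_def by (rule eq_matI) (auto split: nat.split)
  define V where "V = P * W"
  have V: "V \<in> carrier_mat (Suc n) (Suc n)" using P W unfolding V_def by auto
  have tV: "transpose_mat V = transpose_mat W * P"
    unfolding V_def using P W by (simp add: transpose_mult[of _ "Suc n" "Suc n" _ "Suc n"])
  note assoc = assoc_mult_mat[of _ "Suc n" "Suc n" _ "Suc n" _ "Suc n"]
  have tW': "transpose_mat W \<in> carrier_mat (Suc n) (Suc n)" using W by simp
  have "V * transpose_mat V = P * (W * transpose_mat W) * P"
    unfolding tV unfolding V_def using P(1) W tW' by (simp add: assoc)
  also have "\<dots> = 1\<^sub>m (Suc n)" unfolding WW using P by simp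
  finally have VV: "V * transpose_mat V = 1\<^sub>m (Suc n)" .
  have "V * D * transpose_mat V = P * B * P"
    unfolding tV BW unfolding V_def using P(1) W tW' D by (simp add: assoc)
  also have "\<dots> = (P * P) * A * (P * P)"
    unfolding B_def using P(1) A by (simp add: assoc)
  also have "\<dots> = A" unfolding P(3) using A by simp
  finally have "A = V * mat_diag (Suc n) (case_nat k l) * transpose_mat V" unfolding D' ..
  thus ?case using V VV by blast
qed

section \<open>The signless Laplacian as a quadratic form\<close>

text \<open>The matrix acts here on functions instead of \<open>vec\<close>, so that later arguments
  handle finite sums only.\<close>

definition Qop :: "graph \<Rightarrow> (nat \<Rightarrow> real) \<Rightarrow> nat \<Rightarrow> real" where
  "Qop G x i = real (degree G i) * x i + (\<Sum>j | j < fst G \<and> snd G i j. x j)"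

text \<open>\<open>u k\<close> is the \<open>k\<close>-th eigenvector. Orthonormality and its dual
  relation, completeness, are both recorded; the latter gives Parseval's identity.\<close>

definition eigenbasis :: "graph \<Rightarrow> (nat \<Rightarrow> nat \<Rightarrow> real) \<Rightarrow> (nat \<Rightarrow> real) \<Rightarrow> bool" where
  "eigenbasis G u l \<longleftrightarrow>
    (\<forall>k<fst G. \<forall>m<fst G. (\<Sum>i<fst G. u k i * u m i) = of_bool (k = m)) \<and>
    (\<forall>i<fst G. \<forall>j<fst G. (\<Sum>k<fst G. u k i * u k j) = of_bool (i = j)) \<and>
    (\<forall>k<fst G. \<forall>i<fst G. Qop G (u k) i = l k * u k i)"

lemma sum_Collect_less_conj:
  "(\<Sum>j | j < n \<and> P j. f j) = (\<Sum>j<n. if P j then f j else 0)" for n :: nat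
  by (simp add: sum.If_cases Int_def)

lemma simple_graph_sym: "simple_graph G \<Longrightarrow> snd G i j \<longleftrightarrow> snd G j i"
  and simple_graph_irrefl: "simple_graph G \<Longrightarrow> \<not> snd G i i"
  unfolding simple_graph_def by (auto split: prod.splits)

lemma Qop_signless_laplacian:
  assumes "i < fst G"
  shows "(\<Sum>j<fst G. signless_laplacian G $$ (i,j) * x j) = Qop G x i"
proof -
  have "(\<Sum>j<fst G. signless_laplacian G $$ (i,j) * x j) =
     (\<Sum>j<fst G. (if i = j then real (degree G i) * x i else 0) + (if snd G i j then x j else 0))"
    using assms by (intro sum.cong) (auto simp: signless_laplacian_def algebra_simps)
  thus ?thesis
    using assms by (simp add: sum.distrib Qop_def sum_Collect_less_conj)
qed

lemma Qop_selfadjoint: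
  assumes "simple_graph G"
  shows "(\<Sum>i<fst G. y i * Qop G x i) = (\<Sum>i<fst G. x i * Qop G y i)"
proof -
  have "(\<Sum>i<fst G. \<Sum>j<fst G. y i * (if snd G i j then x j else 0)) =
    (\<Sum>j<fst G. \<Sum>i<fst G. y i * (if snd G i j then x j else 0))"
    by (rule sum.swap)
  also have "\<dots> = (\<Sum>i<fst G. \<Sum>j<fst G. x i * (if snd G i j then y j else 0))"
    using simple_graph_sym[OF assms] by (intro sum.cong refl) (auto simp: mult.commute)
  finally show ?thesis
    unfolding Qop_def sum_Collect_less_conj
    by (simp add: distrib_left sum.distrib sum_distrib_left mult_ac)
qed

lemma Qop_linear: "Qop G (\<lambda>i. a * x i + b * y i) i = a * Qop G x i + b * Qop G y i"
  unfolding Qop_def by (simp add: sum.distrib algebra_simps sum_distrib_left)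

lemma order_prod_list_linear:
  "order x (\<Prod>a\<leftarrow>xs. [:- a, 1:]) = length (filter ((=) x) xs)" for x :: "'a :: field"
proof (induction xs)
  case (Cons a xs)
  have "order x [:- a, 1:] = (if x = a then 1 else 0)"
    using order_power_n_n[of a 1] by (auto intro: order_0I)
  moreover have "(\<Prod>b\<leftarrow>xs. [:- b, 1:]) \<noteq> 0"
    by (auto simp: prod_list_zero_iff)
  hence "[:- a, 1:] * (\<Prod>b\<leftarrow>xs. [:- b, 1:]) \<noteq> 0"
    by (metis mult_eq_0_iff one_neq_zero pCons_eq_0_iff)
  ultimately show ?case using Cons.IH by (simp add: order_mult del: mult_pCons_left)
qed (simp add: order_0I)

text \<open>The columns of the diagonalizing matrix form the basis; the multiplicities are read off
  the characteristic polynomial, which is invariant under similarity.\<close>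

lemma eigenbasis_exists:
  assumes G: "simple_graph G"
  shows "\<exists>u l. eigenbasis G u l \<and> (\<forall>x. Q_spectrum G x = card {k. k < fst G \<and> l k = x})"
proof -
  define n where "n = fst G"
  define A where "A = signless_laplacian G"
  have A: "A \<in> carrier_mat n n" unfolding A_def n_def signless_laplacian_def by simp
  have "transpose_mat A = A"
    unfolding A_def signless_laplacian_def
    by (rule eq_matI) (auto simp: simple_graph_sym[OF G])
  then obtain U l where U: "U \<in> carrier_mat n n" "U * transpose_mat U = 1\<^sub>m n"
    and AU: "A = U * mat_diag n l * transpose_mat U"
    using symmetric_real_mat_orthogonally_diagonalizable[OF A] by blast
  have tU: "transpose_mat U \<in> carrier_mat n n" using U by simp
  have UU: "transpose_mat U * U = 1\<^sub>m n"
    by (rule mat_mult_left_right_inverse[OF U(1) tU U(2)])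
  define D where "D = mat_diag n l"
  have D: "D \<in> carrier_mat n n" unfolding D_def by simp
  define u where "u k i = U $$ (i,k)" for k i
  have "(\<Sum>i<n. u k i * u m i) = of_bool (k = m)" if "k < n" "m < n" for k m
  proof -
    have "(\<Sum>i<n. u k i * u m i) = (transpose_mat U * U) $$ (k,m)"
      using U that by (simp add: scalar_prod_def u_def lessThan_atLeast0)
    thus ?thesis unfolding UU using that by simp
  qed
  moreover have "(\<Sum>k<n. u k i * u k j) = of_bool (i = j)" if "i < n" "j < n" for i j
  proof -
    have "(\<Sum>k<n. u k i * u k j) = (U * transpose_mat U) $$ (i,j)"
      using U(1) that by (simp add: scalar_prod_def u_def lessThan_atLeast0)
    thus ?thesis unfolding U(2) using that by simp
  qed
  moreover have "Qop G (u k) i = l k * u k i" if "k < n" "i < n" for k i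
  proof -
    have "A * U = U * mat_diag n l * (transpose_mat U * U)"
      unfolding AU D_def[symmetric] using U(1) tU D by (simp add: assoc_mult_mat[of _ n n _ n _ n])
    also have "\<dots> = U * mat_diag n l" unfolding UU using U(1) by (simp add: right_mult_one_mat[of _ n n])
    finally have "(A * U) $$ (i,k) = (U * mat_diag n l) $$ (i,k)" by simp
    moreover have "(A * U) $$ (i,k) = (\<Sum>j<n. A $$ (i,j) * u k j)"
      using U A that by (simp add: scalar_prod_def u_def lessThan_atLeast0)
    moreover have "(U * mat_diag n l) $$ (i,k) = l k * u k i"
      using that by (simp add: mat_diag_mult_right[OF U(1)] u_def)
    ultimately show ?thesis
      using Qop_signless_laplacian[of i G "u k"] that unfolding A_def n_def by simp
  qed
  ultimately have "eigenbasis G u l" unfolding eigenbasis_def n_def by blast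
  moreover have "Q_spectrum G x = card {k. k < fst G \<and> l k = x}" for x
  proof -
    have "similar_mat A (mat_diag n l)"
      by (rule similar_matI[of _ _ U "transpose_mat U" n]) (use A U UU AU in auto)
    hence "char_poly A = char_poly (mat_diag n l)" by (rule char_poly_similar)
    also have "\<dots> = (\<Prod>a\<leftarrow>diag_mat (mat_diag n l). [:- a, 1:])"
      by (rule char_poly_upper_triangular[of _ n]) (auto simp: mat_diag_def upper_triangular_def)
    also have "diag_mat (mat_diag n l) = map l [0..<n]"
      unfolding diag_mat_def mat_diag_def by (auto intro: map_cong)
    finally have "Q_spectrum G x = length (filter ((=) x) (map l [0..<n]))"
      unfolding Q_spectrum_def A_def by (simp add: order_prod_list_linear del: map_map)
    also have "\<dots> = card {k. k < n \<and> l k = x}"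
      by (auto simp: length_filter_conv_card intro!: arg_cong[where f = card])
    finally show ?thesis unfolding n_def .
  qed
  ultimately show ?thesis by blast
qed

text \<open>Equal fibre sizes mean equal multisets of values. This transfers every sum over
  eigenvalues between cospectral graphs; a constant \<open>f\<close> even gives equality of the
  orders.\<close>

lemma sum_eq_of_same_fibre_cards:
  fixes l l' :: "nat \<Rightarrow> 'a" and f :: "'a \<Rightarrow> 'b :: comm_monoid_add"
  assumes "\<And>x. card {k. k < n \<and> l k = x} = card {k. k < m \<and> l' k = x}"
  shows "(\<Sum>k<n. f (l k)) = (\<Sum>k<m. f (l' k))"
proof -
  have count: "count (image_mset g (mset_set {..<p})) x = card {k. k < p \<and> g k = x}" for g :: "nat \<Rightarrow> 'a" and p x
  proof -
    have "count (image_mset g (mset_set {..<p})) x = size {#y \<in># image_mset g (mset_set {..<p}). y = x#}"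
      by (simp only: filter_eq_replicate_mset size_replicate_mset)
    also have "\<dots> = card {k. k < p \<and> g k = x}"
      by (simp add: filter_mset_image_mset filter_mset_mset_set lessThan_def)
    finally show ?thesis .
  qed
  have "image_mset l (mset_set {..<n}) = image_mset l' (mset_set {..<m})"
    by (rule multiset_eqI) (simp only: count assms)
  hence "sum_mset (image_mset f (image_mset l (mset_set {..<n}))) =
    sum_mset (image_mset f (image_mset l' (mset_set {..<m})))" by simp
  thus ?thesis by (simp add: sum_unfold_sum_mset multiset.map_comp comp_def)
qed

section \<open>Expansion in the eigenbasis: traces and variational bounds\<close>

context
  fixes G :: graph and u :: "nat \<Rightarrow> nat \<Rightarrow> real" and l :: "nat \<Rightarrow> real"
  assumes G: "simple_graph G" and basis: "eigenbasis G u l"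
begin

lemma eigenbasis_orthonormal:
  "k < fst G \<Longrightarrow> m < fst G \<Longrightarrow> (\<Sum>i<fst G. u k i * u m i) = of_bool (k = m)"
  and eigenbasis_complete:
  "i < fst G \<Longrightarrow> j < fst G \<Longrightarrow> (\<Sum>k<fst G. u k i * u k j) = of_bool (i = j)"
  and eigenbasis_Qop: "k < fst G \<Longrightarrow> i < fst G \<Longrightarrow> Qop G (u k) i = l k * u k i"
  using basis unfolding eigenbasis_def by blast+

lemma eigenbasis_parseval:
  "(\<Sum>i<fst G. x i * y i) =
   (\<Sum>k<fst G. (\<Sum>i<fst G. u k i * x i) * (\<Sum>i<fst G. u k i * y i))"
proof -
  have "(\<Sum>k<fst G. (\<Sum>i<fst G. u k i * x i) * (\<Sum>i<fst G. u k i * y i)) =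
    (\<Sum>k<fst G. \<Sum>i<fst G. \<Sum>j<fst G. x i * y j * (u k i * u k j))"
    unfolding sum_product by (simp add: mult_ac)
  also have "\<dots> = (\<Sum>i<fst G. \<Sum>k<fst G. \<Sum>j<fst G. x i * y j * (u k i * u k j))"
    by (rule sum.swap)
  also have "\<dots> = (\<Sum>i<fst G. \<Sum>j<fst G. \<Sum>k<fst G. x i * y j * (u k i * u k j))"
    by (intro sum.cong refl sum.swap)
  also have "\<dots> = (\<Sum>i<fst G. \<Sum>j<fst G. if i = j then x i * y i else 0)"
    by (intro sum.cong refl) (auto simp: eigenbasis_complete simp flip: sum_distrib_left)
  finally show ?thesis by simp
qed

lemma eigenbasis_coeff_Qop:
  assumes "k < fst G"
  shows "(\<Sum>i<fst G. u k i * Qop G x i) = l k * (\<Sum>i<fst G. u k i * x i)"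
proof -
  have "(\<Sum>i<fst G. u k i * Qop G x i) = (\<Sum>i<fst G. x i * Qop G (u k) i)"
    by (rule Qop_selfadjoint[OF G])
  also have "\<dots> = (\<Sum>i<fst G. x i * (l k * u k i))"
    using assms by (intro sum.cong) (auto simp: eigenbasis_Qop)
  finally show ?thesis by (simp add: sum_distrib_left mult_ac)
qed

lemma Qop_form_eigenbasis:
  "(\<Sum>i<fst G. x i * Qop G x i) = (\<Sum>k<fst G. l k * (\<Sum>i<fst G. u k i * x i)\<^sup>2)"
  unfolding eigenbasis_parseval[of x "Qop G x"]
  by (intro sum.cong) (auto simp: eigenbasis_coeff_Qop power2_eq_square)

lemma norm_eigenbasis: "(\<Sum>i<fst G. (x i)\<^sup>2) = (\<Sum>k<fst G. (\<Sum>i<fst G. u k i * x i)\<^sup>2)"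
  unfolding power2_eq_square by (rule eigenbasis_parseval)

lemma coeff_basis_vector:
  assumes "j < fst G"
  shows "(\<Sum>i<fst G. u k i * of_bool (i = j)) = u k j"
proof -
  have "(\<Sum>i<fst G. u k i * of_bool (i = j)) = (\<Sum>i<fst G. if i = j then u k i else 0)"
    by (intro sum.cong) auto
  thus ?thesis using assms by simp
qed

lemma Qop_basis_vector:
  assumes "j < fst G"
  shows "Qop G (\<lambda>i. of_bool (i = j)) i = (if i = j then real (degree G i) else of_bool (snd G i j))"
proof -
  have "(\<Sum>k | k < fst G \<and> snd G i k. of_bool (k = j)) = (\<Sum>k<fst G. if k = j then of_bool (snd G i j) else 0 :: real)"
    unfolding sum_Collect_less_conj by (intro sum.cong) auto
  thus ?thesis using assms simple_graph_irrefl[OF G, of j] unfolding Qop_def by simp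
qed

text \<open>The trace of the matrix: the degree of \<open>j\<close> is the value of the form at the
  \<open>j\<close>-th unit vector.\<close>

lemma sum_eigenvalues: "(\<Sum>k<fst G. l k) = (\<Sum>i<fst G. real (degree G i))"
proof -
  have "(\<Sum>i<fst G. real (degree G i)) = (\<Sum>i<fst G. \<Sum>k<fst G. l k * (u k i)\<^sup>2)"
  proof (rule sum.cong)
    fix j assume "j \<in> {..<fst G}"
    hence j: "j < fst G" by simp
    have "real (degree G j) = (\<Sum>i<fst G. of_bool (i = j) * Qop G (\<lambda>i. of_bool (i = j)) i)"
    proof -
      have "(\<Sum>i<fst G. of_bool (i = j) * Qop G (\<lambda>i. of_bool (i = j)) i) = (\<Sum>i<fst G. if i = j then real (degree G j) else 0)"
        unfolding Qop_basis_vector[OF j] by (intro sum.cong) auto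
      thus ?thesis using j by simp
    qed
    thus "real (degree G j) = (\<Sum>k<fst G. l k * (u k j)\<^sup>2)"
      unfolding Qop_form_eigenbasis coeff_basis_vector[OF j] .
  qed simp
  also have "\<dots> = (\<Sum>k<fst G. \<Sum>i<fst G. l k * (u k i)\<^sup>2)" by (rule sum.swap)
  also have "\<dots> = (\<Sum>k<fst G. l k)"
    by (intro sum.cong refl)
      (simp add: eigenbasis_orthonormal power2_eq_square flip: sum_distrib_left)
  finally show ?thesis by simp
qed

text \<open>The trace of the squared matrix: column \<open>j\<close> has squared norm
  \<open>d\<^sup>2 + d\<close>, where \<open>d\<close> is the degree of \<open>j\<close>.\<close>

lemma sum_eigenvalues_squared:
  "(\<Sum>k<fst G. (l k)\<^sup>2) = (\<Sum>i<fst G. (real (degree G i))\<^sup>2 + real (degree G i))"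
proof -
  have "(\<Sum>i<fst G. (real (degree G i))\<^sup>2 + real (degree G i)) =
    (\<Sum>i<fst G. \<Sum>k<fst G. (l k)\<^sup>2 * (u k i)\<^sup>2)"
  proof (rule sum.cong)
    fix j assume "j \<in> {..<fst G}"
    hence j: "j < fst G" by simp
    let ?e = "\<lambda>i. of_bool (i = j) :: real"
    have "(\<Sum>i<fst G. (Qop G ?e i)\<^sup>2) =
      (\<Sum>i<fst G. (if i = j then (real (degree G j))\<^sup>2 else 0) + (if snd G j i then 1 else 0))"
      (is "_ = ?R")
      unfolding Qop_basis_vector[OF j] 
      by (intro sum.cong) (auto simp: simple_graph_irrefl[OF G] simple_graph_sym[OF G, of j])
    also have "?R = (real (degree G j))\<^sup>2 + (\<Sum>i<fst G. if snd G j i then 1 else 0)"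
      unfolding sum.distrib using j by simp
    also have "(\<Sum>i<fst G. if snd G j i then 1 else 0) = real (degree G j)"
      unfolding sum_Collect_less_conj[symmetric] degree_def by simp
    finally have "(real (degree G j))\<^sup>2 + real (degree G j) = (\<Sum>k<fst G. (\<Sum>i<fst G. u k i * Qop G ?e i)\<^sup>2)"
      using norm_eigenbasis[of "Qop G ?e"] by simp
    also have "\<dots> = (\<Sum>k<fst G. (l k)\<^sup>2 * (u k j)\<^sup>2)"
      by (rule sum.cong)
        (simp_all only: eigenbasis_coeff_Qop lessThan_iff coeff_basis_vector[OF j] power_mult_distrib)
    finally show "(real (degree G j))\<^sup>2 + real (degree G j) = (\<Sum>k<fst G. (l k)\<^sup>2 * (u k j)\<^sup>2)" .
  qed simp
  also have "\<dots> = (\<Sum>k<fst G. \<Sum>i<fst G. (l k)\<^sup>2 * (u k i)\<^sup>2)" by (rule sum.swap)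
  also have "\<dots> = (\<Sum>k<fst G. (l k)\<^sup>2)"
    by (intro sum.cong refl)
      (simp add: eigenbasis_orthonormal power2_eq_square flip: sum_distrib_left)
  finally show ?thesis by simp
qed

lemma exists_eigenvalue_greater:
  assumes "(\<Sum>i<fst G. x i * Qop G x i) > c * (\<Sum>i<fst G. (x i)\<^sup>2)"
  shows "\<exists>k<fst G. l k > c"
proof (rule ccontr)
  assume "\<not> ?thesis"
  hence "(\<Sum>k<fst G. l k * (\<Sum>i<fst G. u k i * x i)\<^sup>2) \<le> (\<Sum>k<fst G. c * (\<Sum>i<fst G. u k i * x i)\<^sup>2)"
    by (intro sum_mono mult_right_mono) auto
  thus False using assms unfolding Qop_form_eigenbasis norm_eigenbasis[of x] by (simp add: sum_distrib_left)
qed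

text \<open>One half of the Courant-Fischer principle: a plane contains a nonzero combination
  orthogonal to the only eigenvector whose eigenvalue may reach \<open>c\<close>. The alternative
  that \<open>z\<close> vanishes covers linearly dependent \<open>x\<close> and
  \<open>y\<close>.\<close>

lemma Qop_form_less_on_plane:
  assumes few: "card {k. k < fst G \<and> l k \<ge> c} \<le> 1"
  shows "\<exists>a b. (a \<noteq> 0 \<or> b \<noteq> 0) \<and> (let z = (\<lambda>i. a * x i + b * y i) in
    (\<forall>i<fst G. z i = 0) \<or> (\<Sum>i<fst G. z i * Qop G z i) < c * (\<Sum>i<fst G. (z i)\<^sup>2))"
proof -
  define co where "co z k = (\<Sum>i<fst G. u k i * z i)" for z k
  define S where "S = {k. k < fst G \<and> l k \<ge> c}"
  have "finite S" unfolding S_def by simp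
  hence eq: "\<forall>a\<in>S. \<forall>b\<in>S. a = b" using few card_le_Suc0_iff_eq[of S] unfolding S_def by simp
  \<comment> \<open>If \<open>S\<close> is empty, \<open>m\<close> is arbitrary, and cancelling its
    coefficient does no harm.\<close>
  obtain m where m: "S \<subseteq> {m}"
  proof (cases "S = {}")
    case False
    then obtain m where "m \<in> S" by blast
    hence "S \<subseteq> {m}" using eq by blast
    thus thesis by (rule that)
  qed (use that in blast)
  \<comment> \<open>This pair cancels the coefficient of \<open>z\<close> at \<open>m\<close>; if
    both coefficients vanish, any nonzero pair does so, and \<open>(1, 0)\<close> is taken.\<close>
  define a where "a = (if co x m = 0 \<and> co y m = 0 then 1 else co y m)"
  define b where "b = (if co x m = 0 \<and> co y m = 0 then 0 else - co x m)"
  define z where "z i = a * x i + b * y i" for i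
  have ab: "a \<noteq> 0 \<or> b \<noteq> 0" unfolding a_def b_def by auto
  have "co z m = a * co x m + b * co y m"
    unfolding co_def z_def by (simp add: sum.distrib algebra_simps sum_distrib_left)
  hence cm: "co z m = 0" unfolding a_def b_def by auto
  have "(\<Sum>i<fst G. z i * Qop G z i) < c * (\<Sum>i<fst G. (z i)\<^sup>2)" if nz: "\<not> (\<forall>i<fst G. z i = 0)"
  proof -
    obtain i where i: "i < fst G" "z i \<noteq> 0" using nz by auto
    have "(\<Sum>i<fst G. (z i)\<^sup>2) > 0" by (rule sum_pos2[of _ i]) (use i in auto)
    hence "(\<Sum>k<fst G. (co z k)\<^sup>2) \<noteq> 0" unfolding norm_eigenbasis[of z] co_def by simp
    then obtain k where k: "k < fst G" "co z k \<noteq> 0"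
      by (metis (no_types, lifting) lessThan_iff power_zero_numeral sum.neutral)
    have less: "l j < c" if "j < fst G" "co z j \<noteq> 0" for j
      using m cm that unfolding S_def by force
    have "(\<Sum>k<fst G. l k * (co z k)\<^sup>2) < (\<Sum>k<fst G. c * (co z k)\<^sup>2)"
    proof (rule sum_strict_mono_ex1)
      show "\<forall>j\<in>{..<fst G}. l j * (co z j)\<^sup>2 \<le> c * (co z j)\<^sup>2"
        using less by (auto simp: mult_le_cancel_right not_less intro: less_imp_le)
      show "\<exists>j\<in>{..<fst G}. l j * (co z j)\<^sup>2 < c * (co z j)\<^sup>2"
        using less[OF k] k by (intro bexI[of _ k]) auto
    qed simp
    thus ?thesis unfolding Qop_form_eigenbasis norm_eigenbasis[of z] co_def by (simp add: sum_distrib_left)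
  qed
  thus ?thesis using ab unfolding z_def Let_def by blast
qed

end

section \<open>Degrees and large eigenvalues\<close>

abbreviation nbrs :: "graph \<Rightarrow> nat \<Rightarrow> nat set" where
  "nbrs G i \<equiv> {j. j < fst G \<and> snd G i j}"

lemma abs_sum_nbrs_le:
  assumes "\<And>j. j \<in> nbrs G i \<Longrightarrow> \<bar>x j\<bar> \<le> X"
  shows "\<bar>\<Sum>j\<in>nbrs G i. x j\<bar> \<le> real (degree G i) * X"
proof -
  have "\<bar>\<Sum>j\<in>nbrs G i. x j\<bar> \<le> (\<Sum>j\<in>nbrs G i. \<bar>x j\<bar>)" by (rule sum_abs)
  also have "\<dots> \<le> (\<Sum>j\<in>nbrs G i. X)" using assms by (rule sum_mono)
  finally show ?thesis by (simp add: degree_def)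
qed

lemma finite_ex_maximum:
  fixes f :: "'a \<Rightarrow> real"
  assumes "finite S" "S \<noteq> {}"
  shows "\<exists>m\<in>S. \<forall>j\<in>S. f j \<le> f m"
proof -
  have "Max (f ` S) \<in> f ` S" using assms by (intro Max_in) auto
  then obtain m where m: "m \<in> S" "Max (f ` S) = f m" by auto
  have "f j \<le> f m" if "j \<in> S" for j
    unfolding m(2)[symmetric] using assms that by (intro Max_ge) auto
  thus ?thesis using m(1) by blast
qed

text \<open>If \<open>x v = 0\<close>, a coordinate of maximal absolute value sits at a vertex of
  degree \<open>d \<le> 5\<close>. Its row gives \<open>lam - d \<le> d\<close>, contrary to
  \<open>lam > 10\<close>.\<close>

lemma eigenvector_nonzero_at_high_degree_vertex:
  assumes deg: "\<And>i. i < fst G \<Longrightarrow> i \<noteq> v \<Longrightarrow> degree G i \<le> 5"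
    and lam: "lam > 10" and ev: "\<And>i. i < fst G \<Longrightarrow> Qop G x i = lam * x i"
    and nz: "j < fst G" "x j \<noteq> 0"
  shows "x v \<noteq> 0"
proof
  assume xv: "x v = 0"
  have fin: "finite {..<fst G}" "{..<fst G} \<noteq> {}" using nz by auto
  obtain i where i: "i < fst G" and max: "\<And>j. j < fst G \<Longrightarrow> \<bar>x j\<bar> \<le> \<bar>x i\<bar>"
    using finite_ex_maximum[OF fin, of "\<lambda>i. \<bar>x i\<bar>"] by auto
  have pos: "\<bar>x i\<bar> > 0" using max[OF nz(1)] nz(2) by linarith
  hence d: "degree G i \<le> 5" using deg[OF i] xv by force
  have "\<bar>(lam - real (degree G i)) * x i\<bar> \<le> real (degree G i) * \<bar>x i\<bar>"
  proof -
    have "(lam - real (degree G i)) * x i = (\<Sum>j\<in>nbrs G i. x j)"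
      using ev[OF i] unfolding Qop_def by (simp add: algebra_simps)
    thus ?thesis using abs_sum_nbrs_le[of G i x "\<bar>x i\<bar>"] max by simp
  qed
  hence "\<bar>lam - real (degree G i)\<bar> \<le> real (degree G i)"
    using pos by (simp add: abs_mult mult_le_cancel_right)
  thus False using lam d by linarith
qed

text \<open>Away from \<open>v\<close> the eigenvector is at most \<open>1 / (lam - 9)\<close>, and its sum over the neighbours of
  \<open>v\<close> is \<open>lam - degree v\<close>.\<close>

lemma dominating_vertex_of_large_eigenvalue:
  assumes G: "simple_graph G" and v: "v < fst G" and n: "fst G \<ge> 16"
    and deg: "\<And>i. i < fst G \<Longrightarrow> i \<noteq> v \<Longrightarrow> degree G i \<le> 5"
    and lam: "lam > real (fst G)" and ev: "\<And>i. i < fst G \<Longrightarrow> Qop G x i = lam * x i"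
    and xv: "x v = 1"
  shows "degree G v \<ge> fst G - 1"
proof (rule ccontr)
  assume "\<not> ?thesis"
  hence dv: "real (degree G v) \<le> real (fst G) - 2" using n by linarith
  have bound: "\<bar>x i\<bar> \<le> 1 / (lam - 9)" if i0: "i < fst G" "i \<noteq> v" for i
  proof -
    let ?S = "{..<fst G} - {v}"
    have fin: "finite ?S" "?S \<noteq> {}" using i0 by auto
    obtain m where m: "m < fst G" "m \<noteq> v" and max: "\<And>j. j < fst G \<Longrightarrow> j \<noteq> v \<Longrightarrow> \<bar>x j\<bar> \<le> \<bar>x m\<bar>"
      using finite_ex_maximum[OF fin, of "\<lambda>i. \<bar>x i\<bar>"] by auto
    define X where "X = \<bar>x m\<bar>"
    have X: "X \<ge> 0" unfolding X_def by simp
    have d: "real (degree G m) \<le> 5" using deg[OF m] by simp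
    have eq: "(lam - real (degree G m)) * x m = (\<Sum>j\<in>nbrs G m. x j)"
      using ev[OF m(1)] unfolding Qop_def by (simp add: algebra_simps)
    have abs: "\<bar>(lam - real (degree G m)) * x m\<bar> = (lam - real (degree G m)) * X"
      using lam n d unfolding X_def by (simp add: abs_mult)
    \<comment> \<open>Let \<open>d\<close> be the degree of \<open>m\<close>. If \<open>v\<close> is
      a neighbour of \<open>m\<close>, it contributes \<open>1\<close> and the other
      \<open>d - 1\<close> neighbours at most \<open>X\<close> each, so
      \<open>(lam - 2 * d + 1) * X \<le> 1\<close>; with \<open>d \<le> 5\<close> the factor is at
      least \<open>lam - 9\<close>. Otherwise \<open>X = 0\<close>.\<close>
    have "(lam - 9) * X \<le> 1"
    proof (cases "snd G m v")
      case True
      have vin: "v \<in> nbrs G m" using True v by simp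
      have "\<bar>\<Sum>j\<in>nbrs G m - {v}. x j\<bar> \<le> (\<Sum>j\<in>nbrs G m - {v}. \<bar>x j\<bar>)" by (rule sum_abs)
      also have "\<dots> \<le> (\<Sum>j\<in>nbrs G m - {v}. X)"
        by (rule sum_mono) (use max in \<open>auto simp: X_def\<close>)
      also have "\<dots> = (real (degree G m) - 1) * X"
      proof -
        have "card (nbrs G m) \<ge> 1" using vin by (metis Suc_leI card_gt_0_iff empty_iff finite_Collect_conjI finite_Collect_less_nat One_nat_def)
        thus ?thesis using vin by (simp add: degree_def card_Diff_singleton of_nat_diff)
      qed
      finally have "\<bar>\<Sum>j\<in>nbrs G m. x j\<bar> \<le> 1 + (real (degree G m) - 1) * X"
        using vin xv by (subst sum.remove[of _ v]) auto
      hence "(lam - 2 * real (degree G m) + 1) * X \<le> 1"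
        using eq abs by (simp add: algebra_simps)
      moreover have "(lam - 9) * X \<le> (lam - 2 * real (degree G m) + 1) * X"
        using d X by (intro mult_right_mono) auto
      ultimately show ?thesis by linarith
    next
      case False
      have "\<bar>\<Sum>j\<in>nbrs G m. x j\<bar> \<le> real (degree G m) * X"
        by (rule abs_sum_nbrs_le) (use False max in \<open>auto simp: X_def\<close>)
      hence "(lam - 2 * real (degree G m)) * X \<le> 0"
        using eq abs by (simp add: algebra_simps)
      moreover have "lam - 2 * real (degree G m) > 0" using d lam n by linarith
      ultimately have "X = 0" using X by (simp add: mult_le_0_iff)
      thus ?thesis by simp
    qed
    hence "X \<le> 1 / (lam - 9)" using lam n by (simp add: field_simps)
    thus ?thesis using max[OF i0] unfolding X_def by linarith
  qed
  have "lam - real (degree G v) = (\<Sum>j\<in>nbrs G v. x j)"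
    using ev[OF v] xv unfolding Qop_def by simp
  also have "\<dots> \<le> real (degree G v) * (1 / (lam - 9))"
  proof -
    have "\<bar>x j\<bar> \<le> 1 / (lam - 9)" if "j \<in> nbrs G v" for j
      using that bound[of j] simple_graph_irrefl[OF G, of v] by auto
    hence "\<bar>\<Sum>j\<in>nbrs G v. x j\<bar> \<le> real (degree G v) * (1 / (lam - 9))" by (rule abs_sum_nbrs_le)
    thus ?thesis by linarith
  qed
  finally have "(lam - real (degree G v)) * (lam - 9) \<le> real (degree G v)"
    using lam n by (simp add: field_simps)
  \<comment> \<open>With order \<open>n\<close>, \<open>lam > n\<close> and degree at most
    \<open>n - 2\<close>, the inequalities give \<open>2 * (n - 9) < n - 2\<close>, that is
    \<open>n < 16\<close>. Here the full strength of the bound \<open>16\<close> is needed.\<close>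
  moreover have "(lam - real (degree G v)) * (lam - 9) \<ge> 2 * (lam - 9)"
    using lam n dv by (intro mult_right_mono) auto
  ultimately have "2 * (lam - 9) \<le> real (degree G v)" by (rule order_trans[rotated])
  moreover have "real (fst G) \<ge> 16" using n by simp
  ultimately show False using lam dv by argo
qed

text \<open>On the plane of two unit vectors the form has diagonal entries at least \<open>6\<close>
  and off-diagonal entry \<open>0\<close> or \<open>1\<close>, hence is at least \<open>5\<close>
  times the norm.\<close>

lemma at_most_one_large_degree:
  assumes G: "simple_graph G" and basis: "eigenbasis G u l"
    and few: "card {k. k < fst G \<and> l k \<ge> 5} \<le> 1"
    and i: "i < fst G" "degree G i \<ge> 6" and j: "j < fst G" "degree G j \<ge> 6"
  shows "i = j"
proof (rule ccontr)
  assume ij: "i \<noteq> j"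
  obtain a b where ab: "a \<noteq> 0 \<or> b \<noteq> 0" and
    less: "let z = (\<lambda>k. a * of_bool (k = i) + b * of_bool (k = j)) in
      (\<forall>k<fst G. z k = 0) \<or> (\<Sum>k<fst G. z k * Qop G z k) < 5 * (\<Sum>k<fst G. (z k)\<^sup>2)"
    using Qop_form_less_on_plane[OF G basis few, of "\<lambda>k. of_bool (k = i)" "\<lambda>k. of_bool (k = j)"] by blast
  define z :: "nat \<Rightarrow> real" where "z k = a * of_bool (k = i) + b * of_bool (k = j)" for k
  have z: "z i = a" "z j = b" and z0: "\<And>k. k \<noteq> i \<Longrightarrow> k \<noteq> j \<Longrightarrow> z k = 0"
    using ij unfolding z_def by auto
  have restrict: "(\<Sum>k<fst G. z k * f k) = a * f i + b * f j" for f
  proof -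
    have "(\<Sum>k<fst G. z k * f k) = (\<Sum>k\<in>{i,j}. z k * f k)"
      using i j z0 by (intro sum.mono_neutral_right) auto
    thus ?thesis using ij z by simp
  qed
  let ?e = "of_bool (snd G i j) :: real"
  have Qz: "Qop G z k = a * (if k = i then real (degree G k) else of_bool (snd G k i))
     + b * (if k = j then real (degree G k) else of_bool (snd G k j))" for k
    unfolding z_def Qop_linear Qop_basis_vector[OF G basis i(1)] Qop_basis_vector[OF G basis j(1)] ..
  have form: "(\<Sum>k<fst G. z k * Qop G z k) = real (degree G i) * a\<^sup>2 + real (degree G j) * b\<^sup>2 + 2 * ?e * (a * b)"
    unfolding restrict Qz using ij simple_graph_sym[OF G, of j i]
    by (simp add: power2_eq_square algebra_simps)
  have norm: "(\<Sum>k<fst G. (z k)\<^sup>2) = a\<^sup>2 + b\<^sup>2"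
    unfolding power2_eq_square restrict z ..
  have "\<not> (\<forall>k<fst G. z k = 0)" using ab z i j by metis
  hence "(\<Sum>k<fst G. z k * Qop G z k) < 5 * (\<Sum>k<fst G. (z k)\<^sup>2)"
    using less unfolding Let_def z_def[symmetric] by blast
  hence "real (degree G i) * a\<^sup>2 + real (degree G j) * b\<^sup>2 + 2 * ?e * (a * b) < 5 * a\<^sup>2 + 5 * b\<^sup>2"
    unfolding form norm by simp
  moreover have "6 * a\<^sup>2 \<le> real (degree G i) * a\<^sup>2" "6 * b\<^sup>2 \<le> real (degree G j) * b\<^sup>2"
    using i j by (auto intro!: mult_right_mono)
  moreover have "2 * ?e * (a * b) \<ge> - (a\<^sup>2 + b\<^sup>2)"
    using sum_squares_ge_zero[of a b] zero_le_power2[of "a + b"]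
    by (cases "snd G i j") (auto simp: power2_eq_square algebra_simps)
  ultimately show False by linarith
qed

section \<open>Cones over graphs with degrees 1 and 2\<close>

text \<open>Degrees are those in the whole graph, so a base vertex of degree 2 or 3 has one or two
  neighbours in the base. Both the target and, eventually, the cospectral graph are
  instances.\<close>

locale cone =
  fixes G :: graph and v :: nat
  assumes G: "simple_graph G" and v: "v < fst G"
    and adj: "i < fst G \<Longrightarrow> i \<noteq> v \<Longrightarrow> snd G v i"
    and deg: "i < fst G \<Longrightarrow> i \<noteq> v \<Longrightarrow> degree G i = 2 \<or> degree G i = 3"
begin

definition V :: "nat set" where "V = {..<fst G} - {v}"

definition D :: "nat \<Rightarrow> nat set" where "D d = {i \<in> V. degree G i = d}"

definition N :: "nat \<Rightarrow> nat set" where "N i = {j \<in> V. snd G i j}"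

lemma finite_V [simp]: "finite V" and finite_D [simp]: "finite (D d)" and finite_N [simp]: "finite (N i)"
  unfolding V_def D_def N_def by auto

lemma N_sym: "i \<in> V \<Longrightarrow> j \<in> N i \<Longrightarrow> i \<in> N j"
  using simple_graph_sym[OF G] unfolding N_def by auto

lemma N_irrefl: "i \<notin> N i"
  using simple_graph_irrefl[OF G] unfolding N_def by auto

lemma N_subset: "N i \<subseteq> V"
  unfolding N_def by auto

lemma V_split: "V = D 2 \<union> D 3" and D_disjoint: "D 2 \<inter> D 3 = {}"
  using deg unfolding V_def D_def by auto

lemma nbrs_cone: "i \<in> V \<Longrightarrow> nbrs G i = insert v (N i)" and v_notin_N: "v \<notin> N i"
  using adj v simple_graph_sym[OF G, of v] unfolding V_def N_def by auto

lemma nbrs_apex: "nbrs G v = V"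
  using adj simple_graph_irrefl[OF G] unfolding V_def by auto

lemma card_N: "i \<in> V \<Longrightarrow> degree G i = Suc (card (N i))"
  using nbrs_cone[of i] v_notin_N by (simp add: degree_def)

lemma card_V: "card V = fst G - 1" and degree_apex: "degree G v = fst G - 1"
  using v nbrs_apex by (auto simp: V_def degree_def)

lemma sum_all: "(\<Sum>i<fst G. f i) = f v + (\<Sum>i\<in>V. f i)" for f :: "nat \<Rightarrow> real"
  unfolding V_def using v by (subst sum.remove[of _ v]) auto

lemma Qop_cone: "i \<in> V \<Longrightarrow> Qop G x i = real (degree G i) * x i + x v + (\<Sum>j\<in>N i. x j)"
  unfolding Qop_def by (simp add: nbrs_cone v_notin_N)

lemma Qop_apex: "Qop G x v = (real (fst G) - 1) * x v + (\<Sum>j\<in>V. x j)"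
  unfolding Qop_def nbrs_apex degree_apex using v by (simp add: of_nat_diff)

lemma sum_N_swap:
  fixes f :: "nat \<Rightarrow> nat \<Rightarrow> real"
  shows "(\<Sum>i\<in>V. \<Sum>j\<in>N i. f i j) = (\<Sum>i\<in>V. \<Sum>j\<in>N i. f j i)"
proof -
  have "(\<Sum>i\<in>V. \<Sum>j\<in>N i. f i j) = (\<Sum>j\<in>V. \<Sum>i | i \<in> V \<and> snd G i j. f i j)"
    unfolding N_def by (rule sum.swap_restrict) auto
  thus ?thesis using simple_graph_sym[OF G] unfolding N_def by simp
qed

text \<open>Replace \<open>2 * z i * z j\<close> by
  \<open>(z i)\<^sup>2 + (z j)\<^sup>2 - (z i - z j)\<^sup>2\<close>. A base vertex of degree
  \<open>d\<close> has \<open>d - 1\<close> base neighbours, so its square gets weight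
  \<open>d + (d - 1)\<close>: 3 for degree 2 and 5 for degree 3. The half is due to each base edge
  occurring twice.\<close>

lemma Qop_form_cone:
  assumes z: "z v = 0"
  shows "(\<Sum>i<fst G. z i * Qop G z i) =
    (\<Sum>i\<in>V. (2 * real (degree G i) - 1) * (z i)\<^sup>2) - (\<Sum>i\<in>V. \<Sum>j\<in>N i. (z i - z j)\<^sup>2) / 2"
proof -
  have "(\<Sum>i\<in>V. \<Sum>j\<in>N i. z i * z j) =
    (\<Sum>i\<in>V. \<Sum>j\<in>N i. (z i)\<^sup>2 / 2 + (z j)\<^sup>2 / 2 - (z i - z j)\<^sup>2 / 2)"
    by (intro sum.cong refl) (simp add: power2_eq_square field_simps)
  also have "\<dots> = (\<Sum>i\<in>V. \<Sum>j\<in>N i. (z i)\<^sup>2 / 2) + (\<Sum>i\<in>V. \<Sum>j\<in>N i. (z j)\<^sup>2 / 2)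
     - (\<Sum>i\<in>V. \<Sum>j\<in>N i. (z i - z j)\<^sup>2 / 2)"
    by (simp add: sum.distrib sum_subtractf)
  also have "(\<Sum>i\<in>V. \<Sum>j\<in>N i. (z j)\<^sup>2 / 2) = (\<Sum>i\<in>V. \<Sum>j\<in>N i. (z i)\<^sup>2 / 2)"
    by (rule sum_N_swap)
  also have "(\<Sum>i\<in>V. \<Sum>j\<in>N i. (z i)\<^sup>2 / 2) = (\<Sum>i\<in>V. (real (degree G i) - 1) * (z i)\<^sup>2 / 2)"
    by (intro sum.cong refl) (simp add: card_N)
  finally have cross: "(\<Sum>i\<in>V. \<Sum>j\<in>N i. z i * z j) = (\<Sum>i\<in>V. (real (degree G i) - 1) * (z i)\<^sup>2)
     - (\<Sum>i\<in>V. \<Sum>j\<in>N i. (z i - z j)\<^sup>2) / 2"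
    by (simp add: sum_divide_distrib[symmetric])
  have "(\<Sum>i<fst G. z i * Qop G z i) = (\<Sum>i\<in>V. z i * Qop G z i)" by (simp add: sum_all z)
  also have "\<dots> = (\<Sum>i\<in>V. real (degree G i) * (z i)\<^sup>2 + (\<Sum>j\<in>N i. z i * z j))"
    by (intro sum.cong refl)
      (simp add: Qop_cone z power2_eq_square algebra_simps sum_distrib_left)
  also have "\<dots> = (\<Sum>i\<in>V. real (degree G i) * (z i)\<^sup>2) + (\<Sum>i\<in>V. \<Sum>j\<in>N i. z i * z j)"
    by (rule sum.distrib)
  finally show ?thesis
    unfolding cross by (simp add: sum.distrib[symmetric] sum_subtractf[symmetric] algebra_simps)
qed

text \<open>If the sets were disjoint, their indicators would span a plane of vectors constant along
  base edges and supported on vertices of degree 3, where the form is exactly \<open>5\<close> times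
  the norm.\<close>

lemma closed_sets_meet:
  assumes basis: "eigenbasis G u l" and few: "card {k. k < fst G \<and> l k \<ge> 5} \<le> 1"
    and S: "S \<subseteq> D 3" "S \<noteq> {}" "\<And>i. i \<in> S \<Longrightarrow> N i \<subseteq> S"
    and R: "R \<subseteq> D 3" "R \<noteq> {}" "\<And>i. i \<in> R \<Longrightarrow> N i \<subseteq> R"
  shows "S \<inter> R \<noteq> {}"
proof
  assume SR: "S \<inter> R = {}"
  obtain a b where ab: "a \<noteq> 0 \<or> b \<noteq> 0" and
    less: "let z = (\<lambda>k. a * of_bool (k \<in> S) + b * of_bool (k \<in> R)) in
      (\<forall>k<fst G. z k = 0) \<or> (\<Sum>k<fst G. z k * Qop G z k) < 5 * (\<Sum>k<fst G. (z k)\<^sup>2)"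
    using Qop_form_less_on_plane[OF G basis few, of "\<lambda>k. of_bool (k \<in> S)" "\<lambda>k. of_bool (k \<in> R)"] by blast
  define z :: "nat \<Rightarrow> real" where "z k = a * of_bool (k \<in> S) + b * of_bool (k \<in> R)" for k
  have z0: "z k = 0" if "k \<notin> D 3" for k
    using that S(1) R(1) unfolding z_def by auto
  have zv: "z v = 0" by (rule z0) (simp add: D_def V_def)
  have const: "z i = z j" if ij: "i \<in> V" "j \<in> N i" for i j
  proof -
    have "i \<in> N j" using ij by (rule N_sym)
    hence "i \<in> S \<longleftrightarrow> j \<in> S" "i \<in> R \<longleftrightarrow> j \<in> R" using S(3) R(3) ij by blast+
    thus ?thesis unfolding z_def by simp
  qed
  have "(\<Sum>k<fst G. z k * Qop G z k) = (\<Sum>i\<in>V. (2 * real (degree G i) - 1) * (z i)\<^sup>2)"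
    unfolding Qop_form_cone[of z, OF zv] by (simp add: const)
  also have "\<dots> = (\<Sum>i\<in>V. 5 * (z i)\<^sup>2)"
  proof (intro sum.cong refl)
    fix i assume "i \<in> V"
    show "(2 * real (degree G i) - 1) * (z i)\<^sup>2 = 5 * (z i)\<^sup>2"
      using z0[of i] by (cases "i \<in> D 3") (auto simp: D_def)
  qed
  also have "\<dots> = 5 * (\<Sum>k<fst G. (z k)\<^sup>2)"
    by (simp add: sum_all zv sum_distrib_left)
  finally have "\<forall>k<fst G. z k = 0"
    using less unfolding Let_def z_def[symmetric] by simp
  moreover obtain i j where ij: "i \<in> S" "j \<in> R" using S(2) R(2) by blast
  moreover have "i < fst G" "j < fst G" using ij S(1) R(1) unfolding D_def V_def by auto
  moreover have "z i = a" "z j = b" using ij SR unfolding z_def by auto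
  ultimately show False using ab by metis
qed

text \<open>On vectors vanishing at the apex the quadratic form is at most \<open>5\<close> times the norm. Equality
  makes such a vector constant along the edges of the base and zero on vertices of degree 2; an
  eigenvector for \<open>5\<close> of this form sums to zero, hence vanishes if the base is connected on
  the vertices of degree 3.\<close>

lemma at_most_one_eigenvalue_ge_5:
  assumes basis: "eigenbasis G u l"
    and conn: "\<And>z :: nat \<Rightarrow> real. (\<And>i j. i \<in> V \<Longrightarrow> j \<in> N i \<Longrightarrow> z i = z j) \<Longrightarrow>
      \<exists>c. \<forall>i\<in>D 3. z i = c"
  shows "card {k. k < fst G \<and> l k \<ge> 5} \<le> 1"
proof -
  have "k = m" if k: "k < fst G" "l k \<ge> 5" and m: "m < fst G" "l m \<ge> 5" for k m
  proof (rule ccontr)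
    assume km: "k \<noteq> m"
    \<comment> \<open>Two eigenvectors always have a nonzero combination that vanishes at the
      apex.\<close>
    define a where "a = (if u k v = 0 \<and> u m v = 0 then 1 else u m v)"
    define b where "b = (if u k v = 0 \<and> u m v = 0 then 0 else - u k v)"
    have ab: "a\<^sup>2 + b\<^sup>2 > 0" unfolding a_def b_def by (auto simp: sum_power2_gt_zero_iff)
    define z where "z i = a * u k i + b * u m i" for i
    have zv: "z v = 0" unfolding z_def a_def b_def by auto
    have Qz: "Qop G z i = a * l k * u k i + b * l m * u m i" if "i < fst G" for i
      unfolding z_def[abs_def] Qop_linear using k m that by (simp add: eigenbasis_Qop[OF G basis])
    note on = eigenbasis_orthonormal[OF G basis]
    have prod: "(\<Sum>i<fst G. (a * u k i + b * u m i) * (p * u k i + r * u m i)) = a * p + b * r" for p r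
    proof -
      have "(\<Sum>i<fst G. (a * u k i + b * u m i) * (p * u k i + r * u m i)) =
        (\<Sum>i<fst G. a * p * (u k i * u k i) + a * r * (u k i * u m i) + b * p * (u m i * u k i) + b * r * (u m i * u m i))"
        by (intro sum.cong refl) (simp add: algebra_simps)
      thus ?thesis using k m km by (simp add: sum.distrib on flip: sum_distrib_left)
    qed
    have norm: "(\<Sum>i<fst G. (z i)\<^sup>2) = a\<^sup>2 + b\<^sup>2"
      unfolding power2_eq_square z_def prod ..
    have "(\<Sum>i<fst G. z i * Qop G z i) = (\<Sum>i<fst G. z i * (a * l k * u k i + b * l m * u m i))"
      by (intro sum.cong refl) (simp add: Qz)
    also have "\<dots> = l k * a\<^sup>2 + l m * b\<^sup>2"
      unfolding z_def prod by (simp add: power2_eq_square)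
    finally have form: "(\<Sum>i<fst G. z i * Qop G z i) = l k * a\<^sup>2 + l m * b\<^sup>2" .
    \<comment> \<open>\<open>P\<close> and \<open>R\<close> measure how far the form falls short of
      \<open>5\<close> times the norm: \<open>P\<close> on vertices of degree 2, \<open>R\<close>
      along base edges.\<close>
    define P where "P = (\<Sum>i\<in>V. (6 - 2 * real (degree G i)) * (z i)\<^sup>2)"
    define R where "R = (\<Sum>i\<in>V. \<Sum>j\<in>N i. (z i - z j)\<^sup>2)"
    have Pnn: "(6 - 2 * real (degree G i)) * (z i)\<^sup>2 \<ge> 0" if "i \<in> V" for i
      using that deg[of i] by (auto simp: V_def)
    have P: "P \<ge> 0" unfolding P_def by (intro sum_nonneg Pnn)
    have R: "R \<ge> 0" unfolding R_def by (intro sum_nonneg) auto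
    have "(\<Sum>i\<in>V. (2 * real (degree G i) - 1) * (z i)\<^sup>2) = 5 * (\<Sum>i\<in>V. (z i)\<^sup>2) - P"
      unfolding P_def by (simp add: sum_distrib_left sum_subtractf[symmetric] algebra_simps)
    also have "(\<Sum>i\<in>V. (z i)\<^sup>2) = a\<^sup>2 + b\<^sup>2" using norm by (simp add: sum_all zv)
    finally have eq: "l k * a\<^sup>2 + l m * b\<^sup>2 = 5 * a\<^sup>2 + 5 * b\<^sup>2 - P - R / 2"
      using form Qop_form_cone[of z] zv unfolding R_def[symmetric] by simp
    have la: "l k * a\<^sup>2 \<ge> 5 * a\<^sup>2" "l m * b\<^sup>2 \<ge> 5 * b\<^sup>2"
      using k m by (auto intro: mult_right_mono)
    \<comment> \<open>Both eigenvalues are at least \<open>5\<close>, so both losses vanish and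
      \<open>z\<close> is an eigenvector for \<open>5\<close>.\<close>
    have P0: "P = 0" and R0: "R = 0" and "l k * a\<^sup>2 = 5 * a\<^sup>2" "l m * b\<^sup>2 = 5 * b\<^sup>2"
      using eq la P R by linarith+
    hence lab: "a * l k = 5 * a" "b * l m = 5 * b" by auto
    have "z i = z j" if ij: "i \<in> V" "j \<in> N i" for i j
    proof -
      have "(\<Sum>j\<in>N i. (z i - z j)\<^sup>2) = 0"
        using R0 ij(1) unfolding R_def by (subst (asm) sum_nonneg_eq_0_iff) (auto intro: sum_nonneg)
      thus ?thesis using ij(2) by (simp add: sum_nonneg_eq_0_iff)
    qed
    then obtain c where c: "\<And>i. i \<in> D 3 \<Longrightarrow> z i = c" using conn by blast
    have z2: "z i = 0" if "i \<in> D 2" for i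
    proof -
      have i: "i \<in> V" using that unfolding D_def by auto
      have "(6 - 2 * real (degree G i)) * (z i)\<^sup>2 = 0"
        using P0 i Pnn unfolding P_def by (subst (asm) sum_nonneg_eq_0_iff) auto
      thus ?thesis using that unfolding D_def by auto
    qed
    have "(\<Sum>i\<in>V. z i) = Qop G z v" by (simp add: Qop_apex zv)
    also have "\<dots> = 5 * z v" unfolding Qz[OF v] z_def lab by (simp add: algebra_simps)
    finally have "(\<Sum>i\<in>V. z i) = 0" using zv by simp
    also have "(\<Sum>i\<in>V. z i) = real (card (D 3)) * c"
      unfolding V_split using D_disjoint by (simp add: sum.union_disjoint z2 c)
    finally have "z i = 0" if "i \<in> D 3" for i
      using that c[OF that] by (auto simp: card_eq_0_iff)
    hence "z i = 0" if "i < fst G" for i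
      using that z2 zv V_split unfolding V_def by blast
    hence "(\<Sum>i<fst G. (z i)\<^sup>2) = 0" by simp
    thus False using norm ab by simp
  qed
  thus ?thesis by (subst One_nat_def, subst card_le_Suc0_iff_eq) auto
qed

text \<open>The eigenvector equation is paired with the vector that is \<open>1\<close> at the apex, \<open>1 / (lam - 5)\<close> on
  vertices of degree 3 and \<open>1 / (lam - 3)\<close> on vertices of degree 2. This would be an eigenvector
  for \<open>lam\<close> if no edge joined vertices of different degrees in the base.\<close>

lemma eigenvector_pairing:
  assumes lam: "lam > 5" and ev: "\<And>i. i < fst G \<Longrightarrow> Qop G x i = lam * x i"
  shows "x v * (real (fst G) - 1 + real (card (D 3)) / (lam - 5) + real (card (D 2)) / (lam - 3) - lam)
    + (1 / (lam - 5) - 1 / (lam - 3)) * (\<Sum>e\<in>D 2. \<Sum>f\<in>N e \<inter> D 3. x e - x f) = 0"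
proof -
  define a where "a = 1 / (lam - 5)"
  define b where "b = 1 / (lam - 3)"
  have a: "(lam - 5) * a = 1" and b: "(lam - 3) * b = 1"
    using lam unfolding a_def b_def by auto
  define w where "w i = (if i = v then 1 else if i \<in> D 3 then a else b)" for i
  have w3: "w i = a" if "i \<in> D 3" for i
    using that unfolding w_def by (auto simp: D_def V_def)
  have w2: "w i = b" if "i \<in> D 2" for i
    using that unfolding w_def by (auto simp: D_def V_def)
  have wv: "w v = 1" unfolding w_def by simp
  have N_split: "(\<Sum>j\<in>N i. w j) = a * real (card (N i \<inter> D 3)) + b * real (card (N i \<inter> D 2))" 
    and N_card: "card (N i) = card (N i \<inter> D 3) + card (N i \<inter> D 2)" for i
  proof -
    have N: "N i = (N i \<inter> D 3) \<union> (N i \<inter> D 2)" using N_subset V_split by blast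
    have disj: "(N i \<inter> D 3) \<inter> (N i \<inter> D 2) = {}" using D_disjoint by blast
    show "card (N i) = card (N i \<inter> D 3) + card (N i \<inter> D 2)"
      using N disj by (metis card_Un_disjoint finite_Int finite_N)
    have "(\<Sum>j\<in>N i. w j) = (\<Sum>j\<in>N i \<inter> D 3. w j) + (\<Sum>j\<in>N i \<inter> D 2. w j)"
      using N disj by (metis sum.union_disjoint finite_Int finite_N)
    thus "(\<Sum>j\<in>N i. w j) = a * real (card (N i \<inter> D 3)) + b * real (card (N i \<inter> D 2))"
      by (simp add: w2 w3)
  qed
  \<comment> \<open>In the base, \<open>w\<close> violates the eigenvalue equation only through
    mixed edges: each neighbour of degree 2 puts \<open>b\<close> in place of \<open>a\<close> into
    the row.\<close>
  have Q3: "Qop G w i - lam * w i = - (a - b) * real (card (N i \<inter> D 2))" if i: "i \<in> D 3" for i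
  proof -
    have iV: "i \<in> V" and "degree G i = 3" using i unfolding D_def by auto
    hence "card (N i \<inter> D 3) + card (N i \<inter> D 2) = 2" using card_N[OF iV] N_card[of i] by simp
    hence c: "real (card (N i \<inter> D 3)) = 2 - real (card (N i \<inter> D 2))" by linarith
    show ?thesis
      unfolding Qop_cone[OF iV] N_split w3[OF i] wv \<open>degree G i = 3\<close> c
      using a by (simp add: algebra_simps)
  qed
  have Q2: "Qop G w i - lam * w i = (a - b) * real (card (N i \<inter> D 3))" if i: "i \<in> D 2" for i
  proof -
    have iV: "i \<in> V" and "degree G i = 2" using i unfolding D_def by auto
    hence "card (N i \<inter> D 3) + card (N i \<inter> D 2) = 1" using card_N[OF iV] N_card[of i] by simp
    hence c: "real (card (N i \<inter> D 2)) = 1 - real (card (N i \<inter> D 3))" by linarith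
    show ?thesis
      unfolding Qop_cone[OF iV] N_split w2[OF i] wv \<open>degree G i = 2\<close> c
      using b by (simp add: algebra_simps)
  qed
  have "(\<Sum>j\<in>V. w j) = a * real (card (D 3)) + b * real (card (D 2))"
    unfolding V_split using D_disjoint by (simp add: sum.union_disjoint w2 w3)
  hence Qv: "Qop G w v - lam * w v = real (fst G) - 1 + real (card (D 3)) * a + real (card (D 2)) * b - lam"
    by (simp add: Qop_apex wv)
  have "0 = (\<Sum>i<fst G. x i * Qop G w i) - (\<Sum>i<fst G. w i * Qop G x i)"
    using Qop_selfadjoint[OF G, of x w] by simp
  also have "(\<Sum>i<fst G. w i * Qop G x i) = (\<Sum>i<fst G. x i * (lam * w i))"
    by (intro sum.cong refl) (simp add: ev)
  also have "(\<Sum>i<fst G. x i * Qop G w i) - \<dots> = (\<Sum>i<fst G. x i * (Qop G w i - lam * w i))"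
    by (simp add: sum_subtractf right_diff_distrib)
  also have "\<dots> = x v * (Qop G w v - lam * w v) + (\<Sum>i\<in>D 2. x i * (Qop G w i - lam * w i))
     + (\<Sum>i\<in>D 3. x i * (Qop G w i - lam * w i))"
    unfolding sum_all unfolding V_split using D_disjoint by (simp add: sum.union_disjoint)
  also have "(\<Sum>i\<in>D 2. x i * (Qop G w i - lam * w i)) = (a - b) * (\<Sum>i\<in>D 2. \<Sum>j\<in>N i \<inter> D 3. x i)"
    unfolding sum_distrib_left by (intro sum.cong refl) (simp add: Q2)
  also have "(\<Sum>i\<in>D 3. x i * (Qop G w i - lam * w i)) = - (a - b) * (\<Sum>i\<in>D 3. \<Sum>j\<in>N i \<inter> D 2. x i)"
    unfolding sum_distrib_left by (intro sum.cong refl) (simp add: Q3 algebra_simps)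
  \<comment> \<open>Counting the mixed edges from their ends of degree 2 merges the two sums into
    differences \<open>x e - x f\<close>.\<close>
  also have "(\<Sum>i\<in>D 3. \<Sum>j\<in>N i \<inter> D 2. x i) = (\<Sum>j\<in>D 2. \<Sum>i\<in>N j \<inter> D 3. x i)"
  proof -
    have "N i \<inter> D 2 = {j \<in> D 2. snd G i j}" for i unfolding N_def D_def by auto
    moreover have "N j \<inter> D 3 = {i \<in> D 3. snd G i j}" for j
      using simple_graph_sym[OF G, of j] unfolding N_def D_def by auto
    ultimately show ?thesis by (simp add: sum.swap_restrict)
  qed
  finally show ?thesis
    unfolding Qv a_def b_def by (simp add: sum_subtractf algebra_simps)
qed

text \<open>Meant for the target, where the double sum over mixed edges is empty. The resulting
  equation for \<open>lam\<close> involves only the order and the degree counts, so it can be reused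
  for a cospectral cone with the same counts.\<close>

lemma main_equation:
  assumes "lam > 5" and "\<And>i. i < fst G \<Longrightarrow> Qop G x i = lam * x i" and "x v \<noteq> 0"
    and unmixed: "\<And>e f. e \<in> D 2 \<Longrightarrow> f \<in> D 3 \<Longrightarrow> \<not> snd G e f"
  shows "real (fst G) - 1 + real (card (D 3)) / (lam - 5) + real (card (D 2)) / (lam - 3) = lam"
proof -
  have "N e \<inter> D 3 = {}" if "e \<in> D 2" for e
    using unmixed[OF that] unfolding N_def by auto
  thus ?thesis using eigenvector_pairing[OF assms(1,2)] assms(3) by simp
qed

text \<open>\<open>main\<close> removes the apex term from the pairing, so the differences over
  mixed edges sum to zero, although each of them would be negative.\<close>

lemma no_mixed_edges:
  assumes lam: "lam > 5" and ev: "\<And>i. i < fst G \<Longrightarrow> Qop G x i = lam * x i" and xv: "x v = 1"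
    and main: "real (fst G) - 1 + real (card (D 3)) / (lam - 5) + real (card (D 2)) / (lam - 3) = lam"
    and e: "e \<in> D 2" and f: "f \<in> D 3"
  shows "\<not> snd G e f"
proof -
  have row: "(lam - real (degree G i)) * x i = 1 + (\<Sum>j\<in>N i. x j)" if "i \<in> V" for i
    using ev[of i] that unfolding Qop_cone[OF that] xv by (simp add: algebra_simps V_def)
  \<comment> \<open>Minimum principle: at the smallest base value, with degree \<open>d\<close>, the
    row gives \<open>(lam - 2 * d + 1) * x m \<ge> 1\<close>, and
    \<open>2 * d - 1 \<le> 5 < lam\<close>.\<close>
  have pos: "x i > 0" if i: "i \<in> V" for i
  proof -
    obtain m where m: "m \<in> V" and min: "\<And>j. j \<in> V \<Longrightarrow> x m \<le> x j"
      using finite_ex_maximum[of V "\<lambda>i. - x i"] i by auto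
    have "(\<Sum>j\<in>N m. x m) \<le> (\<Sum>j\<in>N m. x j)"
      by (intro sum_mono min) (use N_subset in auto)
    hence "(lam - 2 * real (degree G m) + 1) * x m \<ge> 1"
      using row[OF m] by (simp add: card_N[OF m] algebra_simps)
    moreover have "lam - 2 * real (degree G m) + 1 > 0"
      using lam deg[of m] m unfolding V_def by auto
    ultimately have "x m > 0" by (smt (verit) mult_nonneg_nonpos)
    thus ?thesis using min[OF i] by simp
  qed
  \<comment> \<open>\<open>f\<close> is the only base neighbour of \<open>e\<close>, so
    \<open>(lam - 2) * x e = 1 + x f\<close>, whereas \<open>(lam - 3) * x f \<ge> 1 + x e\<close>.
    Together they give \<open>(lam - 2) * (x f - x e) \<ge> x e > 0\<close>.\<close>
  have less: "x e < x f" if e: "e \<in> D 2" and f: "f \<in> N e \<inter> D 3" for e f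
  proof -
    have eV: "e \<in> V" "degree G e = 2" and fV: "f \<in> V" "degree G f = 3"
      using e f unfolding D_def by auto
    have "card (N e) = 1" using card_N[OF eV(1)] eV(2) by simp
    hence "N e = {f}" using f by (auto simp: card_1_singleton_iff)
    hence 1: "(lam - 2) * x e = 1 + x f" using row[OF eV(1)] eV(2) by simp
    have "e \<in> N f" using N_sym[OF eV(1)] f by blast
    hence "(\<Sum>j\<in>N f. x j) = x e + (\<Sum>j\<in>N f - {e}. x j)" by (simp add: sum.remove)
    moreover have "(\<Sum>j\<in>N f - {e}. x j) \<ge> 0"
      by (intro sum_nonneg less_imp_le[OF pos]) (use N_subset in auto)
    ultimately have "(lam - 3) * x f \<ge> 1 + x e" using row[OF fV(1)] fV(2) by simp
    hence "(lam - 2) * x f \<ge> (lam - 2) * x e + x e" using 1 by (simp add: algebra_simps)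
    hence "(lam - 2) * x f > (lam - 2) * x e" using pos[OF eV(1)] by linarith
    thus ?thesis using lam by simp
  qed
  have "1 / (lam - 3) < 1 / (lam - 5)" using lam by (intro divide_strict_left_mono) auto
  hence "(\<Sum>e\<in>D 2. \<Sum>f\<in>N e \<inter> D 3. x e - x f) = 0"
    using eigenvector_pairing[OF lam ev] main by simp
  hence "(\<Sum>e\<in>D 2. \<Sum>f\<in>N e \<inter> D 3. x f - x e) = 0"
    by (simp add: sum_subtractf)
  hence "(\<Sum>f\<in>N e \<inter> D 3. x f - x e) = 0"
    using e less by (subst (asm) sum_nonneg_eq_0_iff) (auto intro!: sum_nonneg simp: less_imp_le)
  hence "\<forall>f\<in>N e \<inter> D 3. x f - x e = 0"
    using e less by (subst (asm) sum_nonneg_eq_0_iff) (auto intro!: less_imp_le)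
  hence "f \<notin> N e" using less[OF e, of f] f by force
  thus ?thesis using f unfolding N_def D_def by auto
qed

end

section \<open>Cycles, perfect matchings and the target graph\<close>

text \<open>Walk without turning back until a vertex repeats. The repeated vertex must be the start,
  because every later vertex already has both neighbours on the walk; the vertices visited are then
  closed under \<open>M\<close>, hence all of \<open>A\<close>.\<close>

lemma two_regular_connected_is_cycle:
  fixes A :: "'a set" and M :: "'a \<Rightarrow> 'a set"
  assumes fin: "finite A" and ne: "A \<noteq> {}"
    and M: "\<And>i. i \<in> A \<Longrightarrow> M i \<subseteq> A" "\<And>i. i \<in> A \<Longrightarrow> card (M i) = 2" "\<And>i. i \<notin> M i"
    and sym: "\<And>i j. i \<in> A \<Longrightarrow> j \<in> M i \<Longrightarrow> i \<in> M j"
    and conn: "\<And>S. S \<subseteq> A \<Longrightarrow> S \<noteq> {} \<Longrightarrow> (\<And>i. i \<in> S \<Longrightarrow> M i \<subseteq> S) \<Longrightarrow> S = A"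
  shows "\<exists>c. bij_betw c {..<card A} A \<and>
    (\<forall>a<card A. \<forall>b<card A. c b \<in> M (c a) \<longleftrightarrow> b = Suc a mod card A \<or> a = Suc b mod card A)"
proof -
  obtain i0 where i0: "i0 \<in> A" using ne by blast
  obtain i1 where i1: "i1 \<in> M i0" using M(2)[OF i0] by (metis card.empty ex_in_conv zero_neq_numeral)
  define nx where "nx a b = (SOME z. z \<in> M b \<and> z \<noteq> a)" for a b
  have nx: "nx a b \<in> M b \<and> nx a b \<noteq> a" if "b \<in> A" for a b
  proof -
    have "\<not> M b \<subseteq> {a}" using M(2)[OF that] card_mono[of "{a}" "M b"] by auto
    hence "\<exists>z. z \<in> M b \<and> z \<noteq> a" by blast
    thus ?thesis unfolding nx_def by (rule someI_ex)
  qed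
  \<comment> \<open>\<open>p k\<close> stores the current and the next vertex, since the step after
    that depends on both.\<close>
  define p where "p k = ((\<lambda>(a, b). (b, nx a b)) ^^ k) (i0, i1)" for k
  define c where "c k = fst (p k)" for k
  have p_Suc: "p (Suc k) = (snd (p k), nx (fst (p k)) (snd (p k)))" for k
    unfolding p_def by (simp add: case_prod_unfold)
  have c_Suc: "c (Suc k) = snd (p k)" for k unfolding c_def p_Suc by simp
  have c_Suc_Suc: "c (Suc (Suc k)) = nx (c k) (c (Suc k))" for k
    unfolding c_Suc p_Suc by (simp add: c_def)
  have c0: "c 0 = i0" "c 1 = i1" using c_Suc[of 0] by (simp_all add: c_def p_def)
  have cA: "c k \<in> A \<and> c (Suc k) \<in> M (c k)" for k
  proof (induction k)
    case 0
    thus ?case using c0 i0 i1 by simp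
  next
    case (Suc k)
    hence "c (Suc k) \<in> A" using M(1) by blast
    thus ?case using nx[of "c (Suc k)"] unfolding c_Suc_Suc by blast
  qed
  have M_mid: "M (c (Suc k)) = {c k, c (Suc (Suc k))}" for k
  proof -
    have 1: "c k \<in> M (c (Suc k))" using cA[of k] sym by blast
    have 2: "c (Suc (Suc k)) \<in> M (c (Suc k))" "c (Suc (Suc k)) \<noteq> c k"
      using nx[of "c (Suc k)" "c k"] cA[of "Suc k"] unfolding c_Suc_Suc by auto
    have "card {c k, c (Suc (Suc k))} = 2" using 2(2) by auto
    moreover have "finite (M (c (Suc k)))" using M(1) cA fin finite_subset by metis
    ultimately show ?thesis
      using 1 2(1) M(2) cA[of "Suc k"] card_subset_eq[of "M (c (Suc k))" "{c k, c (Suc (Suc k))}"] by auto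
  qed
  have c_ne: "c (Suc k) \<noteq> c k" "c (Suc (Suc k)) \<noteq> c k" for k
    using cA[of k] M(3) nx[of "c (Suc k)" "c k"] cA[of "Suc k"] unfolding c_Suc_Suc by auto
  have "\<not> inj c"
    using fin cA by (meson finite_imageD finite_subset image_subsetI infinite_UNIV_nat rangeI)
  hence ex: "\<exists>m. c m \<in> c ` {..<m}"
    unfolding inj_def by (metis imageI lessThan_iff linorder_neqE_nat)
  \<comment> \<open>The first repetition; before it the walk is injective.\<close>
  define m where "m = (LEAST m. c m \<in> c ` {..<m})"
  have m: "c m \<in> c ` {..<m}" unfolding m_def using ex by (rule LeastI_ex)
  have least: "c k \<notin> c ` {..<k}" if "k < m" for k
    using that not_less_Least unfolding m_def by blast
  have inj: "inj_on c {..<m}"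
  proof (rule inj_onI)
    fix x y assume xy: "x \<in> {..<m}" "y \<in> {..<m}" "c x = c y"
    have "\<not> x < y"
    proof
      assume "x < y"
      hence "c y \<in> c ` {..<y}" unfolding xy(3)[symmetric] by (intro imageI) simp
      thus False using least[of y] xy by simp
    qed
    moreover have "\<not> y < x"
    proof
      assume "y < x"
      hence "c x \<in> c ` {..<x}" unfolding xy(3) by (intro imageI) simp
      thus False using least[of x] xy by simp
    qed
    ultimately show "x = y" by linarith
  qed
  obtain j where j: "j < m" "c m = c j" using m by auto
  \<comment> \<open>Otherwise \<open>c (m - 1)\<close> is a neighbour of \<open>c j\<close>, hence
    \<open>c (j - 1)\<close> or \<open>c (j + 1)\<close>. Injectivity leaves
    \<open>m = j + 2\<close>, a return after two steps, which the walk excludes.\<close>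
  have j0: "j = 0"
  proof (rule ccontr)
    assume "j \<noteq> 0"
    then obtain j' where j': "j = Suc j'" by (cases j) auto
    obtain m' where m': "m = Suc m'" using j(1) by (cases m) auto
    have "c m' \<in> M (c m)" using cA[of m'] sym unfolding m' by blast
    hence "c m' = c j' \<or> c m' = c (Suc j)" using M_mid[of j'] j(2) j' by auto
    moreover have "m' \<noteq> j" using j(2) c_ne(1)[of m'] m' by auto
    moreover have "c m' = c j' \<Longrightarrow> m' = j'"
      using j(1) j' m' by (intro inj_onD[OF inj]) auto
    moreover have "m' \<noteq> j \<Longrightarrow> c m' = c (Suc j) \<Longrightarrow> m' = Suc j"
      using j(1) m' by (intro inj_onD[OF inj]) auto
    ultimately have "m' = j' \<or> m' = Suc j" by blast
    hence "m = Suc (Suc j)" using j(1) j' m' by auto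
    thus False using j(2) c_ne(2)[of j] by simp
  qed
  have cm: "c m = c 0" using j j0 by simp
  have m3: "m \<ge> 3"
  proof -
    have "m \<noteq> 0" using j(1) by simp
    moreover have "m \<noteq> 1" "m \<noteq> 2" using c_ne[of 0] cm by (auto simp: numeral_2_eq_2)
    ultimately show ?thesis by linarith
  qed
  have M_first: "M (c 0) = {c 1, c (m - 1)}"
  proof -
    have 1: "c 1 \<in> M (c 0)" using cA[of 0] by simp
    have 2: "c (m - 1) \<in> M (c 0)" using cA[of "m - 1"] sym cm m3 by (metis Suc_diff_1 less_le_trans zero_less_numeral)
    have "c 1 \<noteq> c (m - 1)" using inj_onD[OF inj, of 1 "m - 1"] m3 by auto
    hence "card {c 1, c (m - 1)} = 2" by simp
    moreover have "finite (M (c 0))" using M(1) cA fin finite_subset by metis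
    ultimately show ?thesis
      using 1 2 M(2) cA[of 0] card_subset_eq[of "M (c 0)" "{c 1, c (m - 1)}"] by auto
  qed
  \<comment> \<open>The predecessor is given by cases because subtraction on \<open>nat\<close> does
    not wrap around at \<open>0\<close>.\<close>
  have M_c: "M (c a) = {c (Suc a mod m), c (if a = 0 then m - 1 else a - 1)}" if a: "a < m" for a
  proof (cases a)
    case 0
    thus ?thesis using M_first m3 by simp
  next
    case (Suc a')
    have "c (Suc a) = c (Suc a mod m)" using a cm by (cases "Suc a = m") auto
    thus ?thesis using M_mid[of a'] Suc by (simp add: insert_commute)
  qed
  have "c ` {..<m} = A"
  proof (rule conn)
    show "c ` {..<m} \<subseteq> A" using cA by auto
    show "c ` {..<m} \<noteq> {}" using j(1) by blast
    fix i assume "i \<in> c ` {..<m}"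
    then obtain a where a: "a < m" "i = c a" by auto
    have "Suc a mod m < m" "(if a = 0 then m - 1 else a - 1) < m" using a m3 by auto
    thus "M i \<subseteq> c ` {..<m}" unfolding a(2) M_c[OF a(1)] by blast
  qed
  hence bij: "bij_betw c {..<m} A" using inj unfolding bij_betw_def by simp
  hence mA: "card A = m" using bij_betw_same_card by fastforce
  have "c b \<in> M (c a) \<longleftrightarrow> b = Suc a mod m \<or> a = Suc b mod m" if ab: "a < m" "b < m" for a b
  proof -
    have "Suc a mod m < m" "(if a = 0 then m - 1 else a - 1) < m" using ab m3 by auto
    hence "c b \<in> M (c a) \<longleftrightarrow> b = Suc a mod m \<or> b = (if a = 0 then m - 1 else a - 1)"
      unfolding M_c[OF ab(1)] using inj ab unfolding inj_on_def by blast
    moreover have "b = (if a = 0 then m - 1 else a - 1) \<longleftrightarrow> a = Suc b mod m"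
      using ab by (cases "Suc b = m") auto
    ultimately show ?thesis by blast
  qed
  thus ?thesis using bij unfolding mA by blast
qed

text \<open>Remove an orbit \<open>{x, h x}\<close> and place it at the last two positions. Partners
  thus occupy \<open>2 * k\<close> and \<open>2 * k + 1\<close>, matching the numbering of the
  copies of \<open>K 2\<close>.\<close>

lemma fixpoint_free_involution_enumeration:
  assumes "finite A" and "card A = 2 * q"
    and "\<And>i. i \<in> A \<Longrightarrow> h i \<in> A \<and> h i \<noteq> i \<and> h (h i) = i"
  shows "\<exists>g. bij_betw g {..<2 * q} A \<and>
    (\<forall>a<2 * q. h (g a) = g (if even a then a + 1 else a - 1))"
  using assms
proof (induction q arbitrary: A)
  case 0
  thus ?case by (simp add: bij_betw_def)
next
  case (Suc q)
  obtain x where x: "x \<in> A" using Suc.prems(2) by fastforce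
  define B where "B = A - {x, h x}"
  have hx: "h x \<in> A" "h x \<noteq> x" "h (h x) = x" using Suc.prems(3)[OF x] by auto
  have AB: "A = insert x (insert (h x) B)" unfolding B_def using x hx by auto
  have fB: "finite B" unfolding B_def using Suc.prems(1) by simp
  have "card A = Suc (Suc (card B))"
    unfolding AB using fB hx(2) by (simp add: B_def)
  hence cB: "card B = 2 * q" using Suc.prems(2) by simp
  have "h i \<in> B \<and> h i \<noteq> i \<and> h (h i) = i" if "i \<in> B" for i
    using that Suc.prems(3)[of i] hx unfolding B_def by auto
  from Suc.IH[OF fB cB this] obtain g where g: "bij_betw g {..<2 * q} B"
    and hg: "\<And>a. a < 2 * q \<Longrightarrow> h (g a) = g (if even a then a + 1 else a - 1)" by blast
  define g' where "g' a = (if a < 2 * q then g a else if a = 2 * q then x else h x)" for a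
  have "bij_betw g' {..<2 * q} B"
    using g by (rule bij_betw_cong[THEN iffD1, rotated]) (simp add: g'_def)
  moreover have "bij_betw g' {2 * q, 2 * q + 1} {x, h x}"
    using hx(2) unfolding bij_betw_def inj_on_def g'_def by auto
  moreover have "B \<inter> {x, h x} = {}" unfolding B_def by blast
  ultimately have "bij_betw g' ({..<2 * q} \<union> {2 * q, 2 * q + 1}) (B \<union> {x, h x})"
    by (rule bij_betw_combine)
  moreover have "{..<2 * q} \<union> {2 * q, 2 * q + 1} = {..<2 * Suc q}" by auto
  moreover have "B \<union> {x, h x} = A" using AB by auto
  moreover have "h (g' a) = g' (if even a then a + 1 else a - 1)" if a: "a < 2 * Suc q" for a
  proof -
    have "a < 2 * q \<or> a = 2 * q \<or> a = 2 * q + 1" using a by auto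
    then consider "a < 2 * q" | "a = 2 * q" | "a = 2 * q + 1" by blast
    thus ?thesis
    proof cases
      case 1
      hence "(if even a then a + 1 else a - 1) < 2 * q" by (auto elim!: evenE)
      thus ?thesis using 1 hg[OF 1] unfolding g'_def by simp
    qed (use hx(3) in \<open>auto simp: g'_def\<close>)
  qed
  ultimately show ?case by metis
qed

section \<open>Graph isomorphism and coordinates of the target\<close>

lemma graph_iso_sym:
  assumes "graph_iso G H"
  shows "graph_iso H G"
proof -
  obtain f where f: "bij_betw f {0..<fst G} {0..<fst H}"
    and e: "\<And>i j. i < fst G \<Longrightarrow> j < fst G \<Longrightarrow> snd G i j \<longleftrightarrow> snd H (f i) (f j)"
    using assms unfolding graph_iso_def by blast
  define h where "h = inv_into {0..<fst G} f"
  have h: "bij_betw h {0..<fst H} {0..<fst G}" unfolding h_def by (rule bij_betw_inv_into[OF f])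
  have "h i < fst G" "f (h i) = i" if "i < fst H" for i
    using bij_betwE[OF h] bij_betw_inv_into_right[OF f, of i] that unfolding h_def by auto
  hence "snd H i j \<longleftrightarrow> snd G (h i) (h j)" if "i < fst H" "j < fst H" for i j
    using e that by metis
  thus ?thesis using h unfolding graph_iso_def by blast
qed

lemma fst_graph_operations [simp]:
  "fst (disj_union G H) = fst G + fst H" "fst (join G H) = fst G + fst H"
  "fst (K n) = n" "fst (C n) = n"
  by (simp_all add: disj_union_def join_def complete_graph_def cycle_graph_def split: prod.split)

lemma fst_copies_K2: "fst (copies q (K 2)) = 2 * q"
  by (induction q) simp_all

lemma snd_copies_K2:
  "snd (copies q (K 2)) i j \<longleftrightarrow> i < 2 * q \<and> j < 2 * q \<and> i \<noteq> j \<and> i div 2 = j div 2"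
proof (induction q arbitrary: i j)
  case (Suc q)
  have *: "snd (copies (Suc q) (K 2)) i j \<longleftrightarrow>
    (i < 2 \<and> j < 2 \<and> i \<noteq> j) \<or> (2 \<le> i \<and> 2 \<le> j \<and> snd (copies q (K 2)) (i - 2) (j - 2))"
    by (cases "copies q (K 2)") (auto simp: disj_union_def complete_graph_def)
  show ?case
  proof (cases "2 \<le> i \<and> 2 \<le> j")
    case True
    then obtain a b where "i = a + 2" "j = b + 2" by (metis le_add_diff_inverse2)
    thus ?thesis unfolding * Suc.IH by simp
  next
    case False
    thus ?thesis unfolding * by (cases "i < 2"; cases "j < 2") auto
  qed
qed simp

abbreviation target :: "nat \<Rightarrow> nat \<Rightarrow> graph" where
  "target s q \<equiv> join (K 1) (disj_union (C s) (copies q (K 2)))"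

lemma fst_target: "fst (target s q) = s + 2 * q + 1"
  by (simp add: fst_copies_K2)

text \<open>Vertex \<open>0\<close> is the apex, \<open>1\<close> to \<open>s\<close> form the
  cycle, and the rest are consecutive pairs. On \<open>{1..s}\<close> the map
  \<open>Suc (i mod s)\<close> is the cyclic successor.\<close>

lemma snd_target:
  assumes s: "s \<ge> 3"
  shows "snd (target s q) i j \<longleftrightarrow> i < s + 2 * q + 1 \<and> j < s + 2 * q + 1 \<and> i \<noteq> j \<and>
    (i = 0 \<or> j = 0 \<or>
     (i \<le> s \<and> j \<le> s \<and> (j = Suc (i mod s) \<or> i = Suc (j mod s))) \<or>
     (s < i \<and> s < j \<and> (i - Suc s) div 2 = (j - Suc s) div 2))"
proof -
  obtain E where E: "copies q (K 2) = (2 * q, E)" using fst_copies_K2[of q] by (cases "copies q (K 2)") auto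
  have EE: "E a b \<longleftrightarrow> a < 2 * q \<and> b < 2 * q \<and> a \<noteq> b \<and> a div 2 = b div 2" for a b
    using snd_copies_K2[of q a b] unfolding E by simp
  show ?thesis
  proof (cases "i = 0 \<or> j = 0")
    case True
    thus ?thesis unfolding E by (auto simp: join_def disj_union_def complete_graph_def cycle_graph_def)
  next
    case False
    then obtain a b where ab: "i = Suc a" "j = Suc b" by (metis not0_implies_Suc)
    have "snd (target s q) i j \<longleftrightarrow>
      (a < s \<and> b < s \<and> a \<noteq> b \<and> (b = Suc a mod s \<or> a = Suc b mod s)) \<or>
      (s \<le> a \<and> s \<le> b \<and> E (a - s) (b - s))"
      unfolding ab E by (simp add: join_def disj_union_def complete_graph_def cycle_graph_def) blast
    moreover have "a - s < 2 * q \<longleftrightarrow> a < s + 2 * q" "b - s < 2 * q \<longleftrightarrow> b < s + 2 * q"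
      "a - s \<noteq> b - s \<longleftrightarrow> a \<noteq> b" if "s \<le> a" "s \<le> b"
      using that by auto
    ultimately show ?thesis unfolding ab EE
      by (cases "a < s"; cases "b < s") (simp_all add: not_less Suc_le_eq)
  qed
qed

lemma simple_graph_target:
  assumes "s \<ge> 3"
  shows "simple_graph (target s q)"
proof -
  have iff: "simple_graph G \<longleftrightarrow> (\<forall>i j. snd G i j \<longrightarrow> i < fst G \<and> j < fst G) \<and>
    (\<forall>i j. snd G i j \<longrightarrow> snd G j i) \<and> (\<forall>i. \<not> snd G i i)" for G
    by (cases G) (simp add: simple_graph_def)
  show ?thesis unfolding iff fst_target snd_target[OF assms]
    by (intro conjI allI impI; (elim conjE disjE)?; simp)
qed

lemma eq_partner_iff:
  "b = (if even a then a + 1 else a - 1) \<longleftrightarrow> a \<noteq> b \<and> a div 2 = b div 2" for a b :: nat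
proof (cases "even a")
  case True
  then obtain k where "a = 2 * k" by (elim evenE)
  thus ?thesis by auto
next
  case False
  then obtain k where "a = 2 * k + 1" by (elim oddE)
  thus ?thesis by auto
qed

section \<open>Recognizing the target graph\<close>

context cone
begin

lemma sum_over_degrees:
  fixes f :: "nat \<Rightarrow> real"
  shows "(\<Sum>i<fst G. f (degree G i)) = f (fst G - 1) + real (card (D 2)) * f 2 + real (card (D 3)) * f 3"
proof -
  have "(\<Sum>i\<in>D d. f (degree G i)) = real (card (D d)) * f d" for d
    by (simp add: D_def)
  thus ?thesis
    unfolding sum_all degree_apex unfolding V_split using D_disjoint by (simp add: sum.union_disjoint)
qed

lemma card_D_sum: "card (D 2) + card (D 3) = fst G - 1"
  using card_V card_Un_disjoint[of "D 2" "D 3"] D_disjoint unfolding V_split by simp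

text \<open>Rayleigh quotient of the vector that is the order minus one at the apex and
  \<open>1\<close> elsewhere. For the star this is an eigenvector whose eigenvalue is the order; the
  edges of the base push the quotient strictly higher.\<close>

lemma exists_eigenvalue_greater_order:
  assumes basis: "eigenbasis G u l" and n: "fst G \<ge> 2"
  shows "\<exists>k<fst G. l k > real (fst G)"
proof (rule exists_eigenvalue_greater[OF G basis])
  define r where "r = real (fst G) - 1"
  have r: "r > 0" "real (card V) = r" using n unfolding r_def card_V by (simp_all add: of_nat_diff)
  define x where "x i = (if i = v then r else 1)" for i
  have xV: "x i = 1" if "i \<in> V" for i using that unfolding x_def V_def by simp
  have xN: "(\<Sum>j\<in>N i. x j) = real (card (N i))" for i
  proof -
    have "(\<Sum>j\<in>N i. x j) = (\<Sum>j\<in>N i. 1)" using N_subset xV by (intro sum.cong) auto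
    thus ?thesis by simp
  qed
  have Qv: "Qop G x v = r * r + r"
    unfolding Qop_apex using r by (simp add: xV) (simp add: x_def r_def)
  have Qi: "Qop G x i \<ge> r + 3" if i: "i \<in> V" for i
    using card_N[OF i] deg[of i] i unfolding Qop_cone[OF i] xV[OF i] xN
    by (auto simp: x_def V_def)
  have "(\<Sum>i<fst G. (x i)\<^sup>2) = r\<^sup>2 + r"
    using r unfolding sum_all by (simp add: xV) (simp add: x_def)
  moreover have "real (fst G) = r + 1" unfolding r_def by simp
  ultimately have "real (fst G) * (\<Sum>i<fst G. (x i)\<^sup>2) = r * (r * r + r) + r * (r + 1)"
    by (simp add: power2_eq_square algebra_simps)
  also have "\<dots> < r * (r * r + r) + r * (r + 3)" using r by simp
  also have "\<dots> = x v * Qop G x v + (\<Sum>i\<in>V. r + 3)"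
    unfolding Qv using r by (simp add: x_def)
  also have "\<dots> \<le> x v * Qop G x v + (\<Sum>i\<in>V. x i * Qop G x i)"
    using Qi by (intro add_left_mono sum_mono) (simp add: xV)
  also have "\<dots> = (\<Sum>i<fst G. x i * Qop G x i)" unfolding sum_all ..
  finally show "real (fst G) * (\<Sum>i<fst G. (x i)\<^sup>2) < (\<Sum>i<fst G. x i * Qop G x i)" .
qed

lemma N_D2:
  assumes unmixed: "\<And>e f. e \<in> D 2 \<Longrightarrow> f \<in> D 3 \<Longrightarrow> \<not> snd G e f" and i: "i \<in> D 2"
  shows "\<exists>j\<in>D 2. N i = {j}"
proof -
  have "i \<in> V" "degree G i = 2" using i unfolding D_def by auto
  hence "card (N i) = 1" using card_N by simp
  then obtain j where j: "N i = {j}" by (auto simp: card_1_singleton_iff)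
  have "j \<in> V" "snd G i j" using j unfolding N_def by auto
  hence "j \<in> D 2" using unmixed[OF i, of j] V_split by blast
  thus ?thesis using j by blast
qed

lemma N_D3:
  assumes unmixed: "\<And>e f. e \<in> D 2 \<Longrightarrow> f \<in> D 3 \<Longrightarrow> \<not> snd G e f" and i: "i \<in> D 3"
  shows "N i \<subseteq> D 3" "card (N i) = 2"
proof -
  have iV: "i \<in> V" "degree G i = 3" using i unfolding D_def by auto
  thus "card (N i) = 2" using card_N by simp
  show "N i \<subseteq> D 3"
    using unmixed[of _ i] i V_split simple_graph_sym[OF G, of i] unfolding N_def by blast
qed

text \<open>The base splits into a matching on \<open>D 2\<close> and a 2-regular graph on
  \<open>D 3\<close>, which \<open>conn\<close> makes a single cycle; enumerations of both are
  concatenated in the coordinates of the target.\<close>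

lemma iso_target:
  assumes s: "s \<ge> 3" "card (D 3) = s" and q: "card (D 2) = 2 * q"
    and unmixed: "\<And>e f. e \<in> D 2 \<Longrightarrow> f \<in> D 3 \<Longrightarrow> \<not> snd G e f"
    and conn: "\<And>S. S \<subseteq> D 3 \<Longrightarrow> S \<noteq> {} \<Longrightarrow> (\<And>i. i \<in> S \<Longrightarrow> N i \<subseteq> S) \<Longrightarrow> S = D 3"
  shows "graph_iso (target s q) G"
proof -
  have DV: "D d \<subseteq> V" for d unfolding D_def by blast
  obtain c where c: "bij_betw c {..<s} (D 3)" and
    cM: "\<And>a b. a < s \<Longrightarrow> b < s \<Longrightarrow> c b \<in> N (c a) \<longleftrightarrow> b = Suc a mod s \<or> a = Suc b mod s"
  proof -
    have "\<exists>c. bij_betw c {..<card (D 3)} (D 3) \<and> (\<forall>a<card (D 3). \<forall>b<card (D 3).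
      c b \<in> N (c a) \<longleftrightarrow> b = Suc a mod card (D 3) \<or> a = Suc b mod card (D 3))"
    proof (rule two_regular_connected_is_cycle)
      show "D 3 \<noteq> {}" using s by auto
      show "i \<in> N j" if "i \<in> D 3" "j \<in> N i" for i j using N_sym that DV by blast
    qed (use N_D3[OF unmixed] N_irrefl conn in auto)
    thus thesis using that unfolding s(2) by blast
  qed
  \<comment> \<open>The partner in the matching; adjacency being symmetric and irreflexive,
    \<open>h\<close> is a fixpoint-free involution of \<open>D 2\<close>.\<close>
  define h where "h i = (THE j. j \<in> N i)" for i
  have Nh: "N i = {h i}" and hD: "h i \<in> D 2" if i: "i \<in> D 2" for i
  proof -
    obtain j where "j \<in> D 2" "N i = {j}" using N_D2[OF unmixed i] by blast
    thus "N i = {h i}" "h i \<in> D 2" unfolding h_def by auto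
  qed
  have "h i \<in> D 2 \<and> h i \<noteq> i \<and> h (h i) = i" if i: "i \<in> D 2" for i
  proof -
    have "i \<in> N (h i)" using N_sym[of i "h i"] Nh[OF i] i DV by auto
    thus ?thesis using hD[OF i] Nh[OF hD[OF i]] N_irrefl[of i] Nh[OF i] by auto
  qed
  then obtain g where g: "bij_betw g {..<2 * q} (D 2)" and
    hg: "\<And>a. a < 2 * q \<Longrightarrow> h (g a) = g (if even a then a + 1 else a - 1)"
    using fixpoint_free_involution_enumeration[OF finite_D q, of h] by blast
  define f where "f i = (if i = 0 then v else if i \<le> s then c (i - 1) else g (i - Suc s))" for i
  let ?n = "s + 2 * q + 1"
  have n: "fst G = ?n" using card_D_sum s q v by simp
  have fc: "f i = c (i - 1)" "f i \<in> D 3" if "i \<noteq> 0" "i \<le> s" for i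
    using that bij_betwE[OF c] unfolding f_def by auto
  have fg: "f i = g (i - Suc s)" "f i \<in> D 2" if "s < i" "i < ?n" for i
    using that bij_betwE[OF g] unfolding f_def by auto
  have fV: "f i \<in> V" if "i \<noteq> 0" "i < ?n" for i
    using fc(2)[of i] fg(2)[of i] that DV by (cases "i \<le> s") auto
  have f0: "f 0 = v" unfolding f_def by simp
  have vV: "v \<notin> V" unfolding V_def by simp
  have "inj_on f {0..<?n}"
  proof (rule linorder_inj_onI)
    fix i j assume ij: "i < j" "i \<in> {0..<?n}" "j \<in> {0..<?n}"
    consider "i = 0" | "i \<noteq> 0" "j \<le> s" | "i \<noteq> 0" "i \<le> s" "s < j" | "s < i" by (meson not_le)
    thus "f i \<noteq> f j"
    proof cases
      case 1
      thus ?thesis using f0 vV fV[of j] ij by auto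
    next
      case 2
      have "i - 1 < s" "j - 1 < s" "i - 1 \<noteq> j - 1" using ij 2 by linarith+
      hence "c (i - 1) \<noteq> c (j - 1)"
        using inj_onD[OF bij_betw_imp_inj_on[OF c], of "i - 1" "j - 1"] by blast
      thus ?thesis using fc(1)[of i] fc(1)[of j] ij 2 by auto
    next
      case 3
      thus ?thesis using fc(2)[of i] fg(2)[of j] ij D_disjoint by auto
    next
      case 4
      have "i - Suc s < 2 * q" "j - Suc s < 2 * q" "i - Suc s \<noteq> j - Suc s" using ij 4 by auto
      hence "g (i - Suc s) \<noteq> g (j - Suc s)"
        using inj_onD[OF bij_betw_imp_inj_on[OF g], of "i - Suc s" "j - Suc s"] by blast
      thus ?thesis using fg(1)[of i] fg(1)[of j] ij 4 by auto
    qed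
  qed auto
  moreover have "f ` {0..<?n} \<subseteq> {0..<?n}"
  proof (rule image_subsetI)
    fix i assume "i \<in> {0..<?n}"
    thus "f i \<in> {0..<?n}" using f0 v fV[of i] n unfolding V_def by (cases "i = 0") auto
  qed
  ultimately have bij: "bij_betw f {0..<?n} {0..<?n}"
    by (simp add: bij_betw_def endo_inj_surj)
  have "snd (target s q) i j \<longleftrightarrow> snd G (f i) (f j)" if i: "i < ?n" and j: "j < ?n" for i j
  proof (cases "i = 0 \<or> j = 0")
    case True
    show ?thesis
    proof (cases "i = j")
      case True
      thus ?thesis using simple_graph_irrefl[OF G] snd_target[OF s(1)] by simp
    next
      case False
      hence "snd (target s q) i j" using True i j unfolding snd_target[OF s(1)] by blast
      moreover have "snd G (f i) (f j)"
        using True False f0 adj[of "f j"] adj[of "f i"] fV[of i] fV[of j] i j simple_graph_sym[OF G]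
        unfolding V_def by (metis DiffE lessThan_iff singletonI)
      ultimately show ?thesis by simp
    qed
  next
    case False
    hence ij: "i \<noteq> 0" "j \<noteq> 0" by auto
    have N: "snd G (f i) (f j) \<longleftrightarrow> f j \<in> N (f i)"
      using fV[OF ij(2) j] unfolding N_def by simp
    have T: "snd (target s q) i j \<longleftrightarrow> i \<noteq> j \<and>
      ((i \<le> s \<and> j \<le> s \<and> (j = Suc (i mod s) \<or> i = Suc (j mod s))) \<or>
       (s < i \<and> s < j \<and> (i - Suc s) div 2 = (j - Suc s) div 2))"
      using i j ij unfolding snd_target[OF s(1)] by simp
    consider "i \<le> s" "j \<le> s" | "i \<le> s" "s < j" | "s < i" "j \<le> s" | "s < i" "s < j" by (meson not_le)
    thus ?thesis
    proof cases
      case 1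
      obtain a b where ab: "i = Suc a" "j = Suc b" using ij by (metis not0_implies_Suc)
      have "f j \<in> N (f i) \<longleftrightarrow> b = Suc a mod s \<or> a = Suc b mod s"
        using cM[of a b] 1 ab fc(1)[OF ij(1)] fc(1)[OF ij(2)] by simp
      moreover have "i = j \<Longrightarrow> f j \<notin> N (f i)" using N_irrefl by simp
      ultimately show ?thesis unfolding N T using 1 ab by auto
    next
      case 2
      have "f i \<in> D 3" "f j \<in> D 2" using fc(2) fg(2) 2 ij i j by auto
      hence "\<not> snd G (f i) (f j)" using unmixed simple_graph_sym[OF G] by blast
      thus ?thesis unfolding T using 2 by auto
    next
      case 3
      have "f i \<in> D 2" "f j \<in> D 3" using fc(2) fg(2) 3 ij i j by auto
      hence "\<not> snd G (f i) (f j)" using unmixed by blast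
      thus ?thesis unfolding T using 3 by auto
    next
      case 4
      define a where "a = i - Suc s"
      define b where "b = j - Suc s"
      have ab: "i = a + Suc s" "j = b + Suc s" "a < 2 * q" "b < 2 * q"
        using 4 i j unfolding a_def b_def by auto
      define a' where "a' = (if even a then a + 1 else a - 1)"
      have a': "a' < 2 * q" using ab(3) unfolding a'_def by (auto elim!: evenE)
      have "N (f i) = {g a'}"
        using Nh[of "g a"] hg[OF ab(3)] fg[OF 4(1) i] unfolding a_def[symmetric] a'_def by simp
      hence "f j \<in> N (f i) \<longleftrightarrow> g b = g a'"
        using fg(1)[OF 4(2) j] unfolding b_def by simp
      also have "\<dots> \<longleftrightarrow> b = a'"
        using bij_betw_imp_inj_on[OF g] a' ab(4) by (auto dest: inj_onD)
      also have "\<dots> \<longleftrightarrow> a \<noteq> b \<and> a div 2 = b div 2"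
        unfolding a'_def by (rule eq_partner_iff)
      finally show ?thesis unfolding N T using 4 ab by auto
    qed
  qed
  thus ?thesis using bij unfolding graph_iso_def n fst_target by blast
qed

end

text \<open>A cycle vertex sees the apex and its two neighbours on the cycle, distinct as
  \<open>s \<ge> 3\<close>; a vertex beyond \<open>s\<close> sees the apex and its partner.\<close>

lemma degree_target:
  assumes s: "s \<ge> 3" and i: "i \<noteq> 0" "i < s + 2 * q + 1"
  shows "degree (target s q) i = (if i \<le> s then 3 else 2)"
proof (cases "i \<le> s")
  case True
  have mod: "k mod s = (if k = s then 0 else k)" if "k \<le> s" for k using that by simp
  have "snd (target s q) i j \<longleftrightarrow> j = 0 \<or> j = Suc (i mod s) \<or> j = (if i = 1 then s else i - 1)" for j
  proof (cases "j \<le> s")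
    case j: True
    show ?thesis
      unfolding snd_target[OF s] mod[OF True] mod[OF j] using s i True j by auto
  next
    case False
    thus ?thesis unfolding snd_target[OF s] mod[OF True] using s i True by auto
  qed
  hence "nbrs (target s q) i = {0, Suc (i mod s), if i = 1 then s else i - 1}"
    unfolding fst_target mod[OF True] using s i True by auto
  moreover have "card {0, Suc (i mod s), if i = 1 then s else i - 1} = 3"
    using s i True by (cases "i = s") (auto simp: card_insert_if)
  ultimately show ?thesis using True unfolding degree_def by simp
next
  case False
  define a where "a = i - Suc s"
  have a: "i = a + Suc s" "a < 2 * q" using False i unfolding a_def by auto
  define a' where "a' = (if even a then a + 1 else a - 1)"
  have a': "a' < 2 * q" using a(2) unfolding a'_def by (auto elim!: evenE)
  have div: "a \<noteq> b \<and> a div 2 = b div 2 \<longleftrightarrow> b = a'" for b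
    unfolding a'_def eq_partner_iff ..
  have "snd (target s q) i j \<longleftrightarrow> j = 0 \<or> j = a' + Suc s" for j
  proof (cases "s < j")
    case True
    then obtain b where b: "j = b + Suc s" by (metis Suc_leI le_add_diff_inverse2)
    show ?thesis unfolding snd_target[OF s] using a a' div[of b] b by auto
  next
    case False
    thus ?thesis unfolding snd_target[OF s] using a a' by auto
  qed
  hence "nbrs (target s q) i = {0, a' + Suc s}" unfolding fst_target using a' by auto
  thus ?thesis using False unfolding degree_def by simp
qed

lemma cone_target:
  assumes s: "s \<ge> 3"
  shows "cone (target s q) 0"
proof
  show "simple_graph (target s q)" by (rule simple_graph_target[OF s])
  show "0 < fst (target s q)" unfolding fst_target by simp
  show "snd (target s q) 0 i" if "i < fst (target s q)" "i \<noteq> 0" for i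
    using that unfolding fst_target snd_target[OF s] by simp
  show "degree (target s q) i = 2 \<or> degree (target s q) i = 3"
    if "i < fst (target s q)" "i \<noteq> 0" for i
    using that degree_target[OF s, of i q] unfolding fst_target by simp
qed

lemma eigenbasis_vector_nonzero:
  assumes "simple_graph G" "eigenbasis G u l" "k < fst G"
  shows "\<exists>i<fst G. u k i \<noteq> 0"
proof (rule ccontr)
  assume "\<not> ?thesis"
  hence "(\<Sum>i<fst G. u k i * u k i) = 0" by simp
  thus False using eigenbasis_orthonormal[OF assms(1,2), of k k] assms(3) by simp
qed

theorem theorem1p1:
  fixes q s :: nat and H :: graph
  assumes "s \<ge> 3"
    and "s + 2 * q + 1 \<ge> 16"
    and "simple_graph H"
    and "Q_spectrum H = Q_spectrum (join (K 1) (disj_union (C s) (copies q (K 2))))"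
  shows "graph_iso H (join (K 1) (disj_union (C s) (copies q (K 2))))"
proof -
  define T where "T = target s q"
  define n where "n = s + 2 * q + 1"
  have s: "s \<ge> 3" and n16: "n \<ge> 16" and H: "simple_graph H" and spec: "Q_spectrum H = Q_spectrum T"
    using assms unfolding T_def n_def by auto
  interpret T: cone T 0 unfolding T_def by (rule cone_target[OF s])
  have nT: "fst T = n" unfolding T_def n_def by (rule fst_target)
  have degT: "degree T i = (if i \<le> s then 3 else 2)" if "i \<noteq> 0" "i < n" for i
    using that degree_target[OF s] unfolding T_def n_def by simp
  have adjT: "snd T i j \<longleftrightarrow> i < n \<and> j < n \<and> i \<noteq> j \<and> (i = 0 \<or> j = 0 \<or>
     (i \<le> s \<and> j \<le> s \<and> (j = Suc (i mod s) \<or> i = Suc (j mod s))) \<or>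
     (s < i \<and> s < j \<and> (i - Suc s) div 2 = (j - Suc s) div 2))" for i j
    unfolding T_def n_def by (rule snd_target[OF s])
  have D3: "T.D 3 = {1..s}" and D2: "T.D 2 = {Suc s..<n}"
    unfolding T.D_def T.V_def nT using degT by (auto simp: n_def split: if_splits)
  have cardT: "card (T.D 3) = s" "card (T.D 2) = 2 * q"
    unfolding D2 D3 by (auto simp: n_def)
  have unmixedT: "\<not> snd T e f" if "e \<in> T.D 2" "f \<in> T.D 3" for e f
    using that unfolding D2 D3 adjT by auto
  have connT: "\<exists>c. \<forall>i\<in>T.D 3. z i = c" if z: "\<And>i j. i \<in> T.V \<Longrightarrow> j \<in> T.N i \<Longrightarrow> z i = z j"
    for z :: "nat \<Rightarrow> real"
  proof -
    have "i < s \<Longrightarrow> z (Suc i) = z 1" for i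
    proof (induction i)
      case (Suc i)
      have "Suc i \<in> T.V" "Suc (Suc i) \<in> T.N (Suc i)"
        using Suc.prems unfolding T.V_def T.N_def nT adjT n_def by auto
      from z[OF this] show ?case using Suc by simp
    qed simp
    hence "\<forall>i\<in>T.D 3. z i = z 1" unfolding D3
      by (metis One_nat_def Suc_le_D atLeastAtMost_iff Suc_le_eq)
    thus ?thesis by blast
  qed

  \<comment> \<open>Transfer of the spectrum to \<open>H\<close>\<close>
  obtain uT lT where bT: "eigenbasis T uT lT"
    and specT: "\<And>x. Q_spectrum T x = card {k. k < fst T \<and> lT k = x}"
    using eigenbasis_exists[OF T.G] by blast
  obtain uH lH where bH: "eigenbasis H uH lH"
    and specH: "\<And>x. Q_spectrum H x = card {k. k < fst H \<and> lH k = x}"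
    using eigenbasis_exists[OF H] by blast
  have cards: "card {k. k < fst H \<and> lH k = x} = card {k. k < fst T \<and> lT k = x}" for x
    using spec specH specT by metis
  note same = sum_eq_of_same_fibre_cards[OF cards]
  have nH: "fst H = n" using same[of "\<lambda>_. 1 :: nat"] nT by simp
  have "(\<Sum>k<n. of_bool (lH k \<ge> 5) :: nat) = (\<Sum>k<n. of_bool (lT k \<ge> 5))"
    using same[of "\<lambda>x. of_bool (x \<ge> 5) :: nat"] nH nT by simp
  moreover have "card {k. k < n \<and> l k \<ge> 5} = (\<Sum>k<n. of_bool (l k \<ge> 5))" for l :: "nat \<Rightarrow> real"
    by (simp add: Int_def)
  \<comment> \<open>The number of eigenvalues that are at least \<open>5\<close> is read off the
    spectrum, so the bound passes from the target to \<open>H\<close>.\<close>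
  ultimately have few: "card {k. k < fst H \<and> lH k \<ge> 5} \<le> 1"
    using T.at_most_one_eigenvalue_ge_5[OF bT connT] nH nT by simp
  obtain k where k: "k < n" "lT k > real n"
    using T.exists_eigenvalue_greater_order[OF bT] n16 unfolding nT by auto
  define lam where "lam = lT k"
  have lam: "lam > real n" "lam > 10" "lam > 5" using k n16 unfolding lam_def by auto
  have evT: "Qop T (uT k) i = lam * uT k i" if "i < fst T" for i
    using eigenbasis_Qop[OF T.G bT] k that unfolding lam_def nT by blast
  have "uT k 0 \<noteq> 0"
  proof -
    obtain j where j: "j < fst T" "uT k j \<noteq> 0"
      using eigenbasis_vector_nonzero[OF T.G bT] k nT by blast
    have "degree T i \<le> 5" if "i < fst T" "i \<noteq> 0" for i using T.deg[OF that] by auto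
    thus ?thesis
      using eigenvector_nonzero_at_high_degree_vertex[of T 0 lam "uT k" j, OF _ lam(2) evT j] by blast
  qed
  hence main: "real n - 1 + real s / (lam - 5) + real (2 * q) / (lam - 3) = lam"
    using T.main_equation[OF lam(3) evT _ unmixedT] unfolding nT cardT by blast
  have "{k'. k' < fst H \<and> lH k' = lam} \<noteq> {}"
  proof -
    have "card {k'. k' < fst T \<and> lT k' = lam} \<noteq> 0" using k nT unfolding lam_def by auto
    thus ?thesis unfolding cards[symmetric] by (metis card.empty)
  qed
  then obtain m where m: "m < fst H" "lH m = lam" by blast

  \<comment> \<open>The apex of \<open>H\<close>\<close>
  have "{..<fst H} \<noteq> {}" using m(1) by blast
  then obtain v where v: "v < fst H" and vmax: "\<And>i. i < fst H \<Longrightarrow> degree H i \<le> degree H v"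
    using finite_ex_maximum[of "{..<fst H}" "\<lambda>i. real (degree H i)"] by auto
  have deg5: "degree H i \<le> 5" if i: "i < fst H" "i \<noteq> v" for i
  proof (rule ccontr)
    assume "\<not> ?thesis"
    hence "degree H i \<ge> 6" "degree H v \<ge> 6" using vmax[OF i(1)] by auto
    thus False using at_most_one_large_degree[OF H bH few i(1) _ v] i(2) by blast
  qed
  have evm: "Qop H (uH m) i = lam * uH m i" if "i < fst H" for i
    using eigenbasis_Qop[OF H bH m(1) that] m(2) by simp
  have uv: "uH m v \<noteq> 0"
  proof -
    obtain j where "j < fst H" "uH m j \<noteq> 0"
      using eigenbasis_vector_nonzero[OF H bH m(1)] by blast
    thus ?thesis
      using eigenvector_nonzero_at_high_degree_vertex[of H v lam "uH m" j, OF deg5 lam(2) evm] by blast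
  qed
  \<comment> \<open>Scaled to \<open>1\<close> at \<open>v\<close>; the summand
    \<open>0 * uH m i\<close> fits it to the two-term form of \<open>Qop_linear\<close>.\<close>
  define x where "x i = 1 / uH m v * uH m i + 0 * uH m i" for i
  have xv: "x v = 1" using uv unfolding x_def by simp
  have ev: "Qop H x i = lam * x i" if "i < fst H" for i
    unfolding x_def[abs_def] Qop_linear evm[OF that] by simp
  have "degree H v \<ge> fst H - 1"
    by (rule dominating_vertex_of_large_eigenvalue[OF H v _ deg5 _ ev xv]) (use lam nH n16 in auto)
  moreover have sub: "nbrs H v \<subseteq> {..<fst H} - {v}" using simple_graph_irrefl[OF H] by auto
  ultimately have nbrs: "nbrs H v = {..<fst H} - {v}"
    using v by (intro card_seteq) (auto simp: degree_def)
  hence dv: "degree H v = n - 1" using v nH by (simp add: degree_def)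

  \<comment> \<open>The degrees of \<open>H\<close>\<close>
  have sum1: "(\<Sum>i<n. real (degree H i)) = (\<Sum>i<n. real (degree T i))"
    using same[of "\<lambda>x. x"] sum_eigenvalues[OF H bH] sum_eigenvalues[OF T.G bT] nH nT by simp
  have sum2: "(\<Sum>i<n. (real (degree H i))\<^sup>2) = (\<Sum>i<n. (real (degree T i))\<^sup>2)"
    using same[of "\<lambda>x. x\<^sup>2"] sum_eigenvalues_squared[OF H bH] sum_eigenvalues_squared[OF T.G bT]
      nH nT sum1 by (simp add: sum.distrib)
  \<comment> \<open>Nonnegative at every natural number and zero only at \<open>2\<close> and
    \<open>3\<close>. By the traces its sum over the degrees is a spectral invariant, and the apex
    of \<open>H\<close> already accounts for all of it.\<close>
  define g where "g d = (real d - 2) * (real d - 3)" for d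
  have g_nonneg: "g d \<ge> 0" and g_zero: "g d = 0 \<longleftrightarrow> d = 2 \<or> d = 3" for d
  proof -
    show "g d = 0 \<longleftrightarrow> d = 2 \<or> d = 3" unfolding g_def by auto
    have "d \<le> 2 \<or> d \<ge> 3" by linarith
    thus "g d \<ge> 0" unfolding g_def by (auto simp: zero_le_mult_iff)
  qed
  have g_sum: "(\<Sum>i<n. g (d i)) = (\<Sum>i<n. (real (d i))\<^sup>2) - 5 * (\<Sum>i<n. real (d i)) + 6 * real n" for d
  proof -
    have "(\<Sum>i<n. g (d i)) = (\<Sum>i<n. (real (d i))\<^sup>2 - 5 * real (d i) + 6)"
      unfolding g_def by (intro sum.cong) (auto simp: power2_eq_square algebra_simps)
    thus ?thesis by (simp add: sum.distrib sum_subtractf sum_distrib_left)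
  qed
  have "(\<Sum>i<n. g (degree H i)) = (\<Sum>i<n. g (degree T i))"
    unfolding g_sum sum1 sum2 ..
  also have "\<dots> = g (n - 1)"
    using T.sum_over_degrees[of g] g_zero[of 2] g_zero[of 3] nT by simp
  also have "(\<Sum>i<n. g (degree H i)) = g (n - 1) + (\<Sum>i\<in>{..<n} - {v}. g (degree H i))"
    using v nH by (subst sum.remove[of _ v]) (auto simp: dv)
  finally have "(\<Sum>i\<in>{..<n} - {v}. g (degree H i)) = 0" by simp
  hence deg23: "degree H i = 2 \<or> degree H i = 3" if "i < n" "i \<noteq> v" for i
    using that g_nonneg g_zero by (subst (asm) sum_nonneg_eq_0_iff) auto
  interpret H: cone H v
  proof
    show "snd H v i" if "i < fst H" "i \<noteq> v" for i using nbrs that by auto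
    show "degree H i = 2 \<or> degree H i = 3" if "i < fst H" "i \<noteq> v" for i
      using deg23 that nH by simp
  qed (fact H v)+
  \<comment> \<open>Degree sum and order are two linear equations that determine the two
    counts.\<close>
  have "real (card (H.D 2)) * 2 + real (card (H.D 3)) * 3 = real (2 * q) * 2 + real s * 3"
    using sum1 H.sum_over_degrees[of real] T.sum_over_degrees[of real] unfolding nH nT cardT by simp
  hence "card (H.D 2) * 2 + card (H.D 3) * 3 = 2 * q * 2 + s * 3" by linarith
  moreover have "card (H.D 2) + card (H.D 3) = 2 * q + s"
    using H.card_D_sum unfolding nH n_def by simp
  ultimately have cardH: "card (H.D 3) = s" "card (H.D 2) = 2 * q" by linarith+

  \<comment> \<open>The base of \<open>H\<close>\<close>
  have unmixed: "\<not> snd H e f" if "e \<in> H.D 2" "f \<in> H.D 3" for e f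
    using H.no_mixed_edges[OF lam(3) ev xv _ that] main unfolding nH cardH by blast
  \<comment> \<open>By symmetry of adjacency the complement of a closed set in \<open>H.D 3\<close>
    is closed, and two disjoint nonempty closed sets are excluded.\<close>
  have "S = H.D 3" if S: "S \<subseteq> H.D 3" "S \<noteq> {}" "\<And>i. i \<in> S \<Longrightarrow> H.N i \<subseteq> S" for S
  proof (rule ccontr)
    assume "S \<noteq> H.D 3"
    hence ne: "H.D 3 - S \<noteq> {}" using S(1) by blast
    have "H.N i \<subseteq> H.D 3 - S" if i: "i \<in> H.D 3 - S" for i
    proof -
      have "i \<in> H.V" using i unfolding H.D_def by blast
      hence "j \<notin> S" if "j \<in> H.N i" for j using H.N_sym that S(3) i by blast
      thus ?thesis using H.N_D3(1)[OF unmixed, of i] i by blast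
    qed
    thus False using H.closed_sets_meet[OF bH few S _ ne] by blast
  qed
  hence "graph_iso T H"
    unfolding T_def by (intro H.iso_target[OF s cardH unmixed]) auto
  thus ?thesis unfolding T_def by (rule graph_iso_sym)
qed

end
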